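(* Let $p$ be an odd prime, $s\ge1$, and let $k_1,\dots,k_s>1$ be odd integers. Consider the equation $$x^2=p^{2a}k_1^{2t_1}\cdots k_s^{2t_s}y^2-p^{a+b}k_1^{t_1+r_1}\cdots k_s^{t_s+r_s}\delta+4,\qquad \delta\in\{-4,4\},$$ in $x,y,a,b,t_1,\dots,t_s$ positive integers and $r_1,\dots,r_s$ nonnegative integers, with $y$ odd, subject to $t_i>r_i$ for $i=1,\dots,s$ and $a\ge b$. Then, except for $(x,y,p,s,r_1,t_1,k_1,a,b,\delta)=(123,1,11,1,1,2,5,1,1,4)$, the only solutions are: (A) if $p\mid y$: $x=p^{a+b}k_1^{t_1+r_1}\cdots k_s^{t_s+r_s}-\frac{\delta}{2}$, $y=p^bk_1^{r_1}\cdots k_s^{r_s}$; (B) if $p\nmid y$ and $p^b=k_1^{t_1+r_1}\cdots k_s^{t_s+r_s}-\frac{\delta}{2}$: $x=p^{2b}-2$, $y=k_1^{r_1}\cdots k_s^{r_s}$, $a=b$. *)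

theory Defs
  imports "HOL-Computational_Algebra.Primes"
begin

end

theory Submission
  imports Defs Complex_Main
begin

text \<open>
  With \<open>U = p\<^sup>b \<Prod>k\<^sub>i^(r\<^sub>i)\<close>, \<open>V = p^(a - b) \<Prod>k\<^sub>i^(t\<^sub>i - r\<^sub>i)\<close> and \<open>\<delta> = 4\<epsilon>\<close> the equation becomes
  \<open>(x - 2) (x + 2) = U\<^sup>2 V (V y\<^sup>2 - 4\<epsilon>)\<close> with coprime factors on the left. If \<open>U\<^sup>2 V\<close> divides one of
  them, comparing sizes gives \<open>y = U\<close>. Otherwise \<open>U = A\<^sub>0 B\<^sub>0\<close> and \<open>V = A\<^sub>1 B\<^sub>1\<close> split accordingly and
  \<open>A\<^sub>1 g A\<^sub>0\<^sup>2 - B\<^sub>1 h B\<^sub>0\<^sup>2 = \<plusminus>4\<close> with \<open>g h = V y\<^sup>2 - 4\<epsilon>\<close>. The fundamental unit for the discriminant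
  \<open>V (V y\<^sup>2 - 4\<epsilon>)\<close> is the square of \<open>(y \<surd>V + \<surd>(V y\<^sup>2 - 4\<epsilon>)) / 2\<close>, so descent forces \<open>A\<^sub>1 = 1\<close>, and
  \<open>A\<^sub>0, B\<^sub>0\<close> are the coefficients of a power of this element or of the unit. Every prime dividing
  \<open>B\<^sub>0\<close> divides \<open>V\<close>, so lifting the exponent shows that \<open>B\<^sub>0 / y\<close> divides the exponent, although it grows
  exponentially; this leaves only the first power and one Fibonacci exception.
\<close>

section \<open>Odd part of the binomial expansion\<close>

text \<open>This is \<open>((A + B) ^ (2 * m + 1) - (A - B) ^ (2 * m + 1)) / (2 * B)\<close> written
  as a polynomial in \<open>w = A\<^sup>2\<close> and \<open>u = B\<^sup>2\<close>. It is therefore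
  an integer even when \<open>A\<close> and \<open>B\<close> are square roots, and the polymorphic
  type allows evaluation over both the integers and the reals.\<close>

definition odd_binom :: "nat \<Rightarrow> 'a \<Rightarrow> 'a \<Rightarrow> 'a :: comm_ring_1" where
  "odd_binom m w u = (\<Sum>k<Suc m. of_nat ((2 * m + 1) choose (2 * k + 1)) * w ^ (m - k) * u ^ k)"

lemma sum_odd_indices:
  fixes f :: "nat \<Rightarrow> 'a :: comm_ring_1"
  shows "(\<Sum>i<2 * N. if even i then 0 else f i) = (\<Sum>k<N. f (2 * k + 1))"
  by (induction N) auto

lemma odd_binom_diff:
  fixes A B :: "'a :: comm_ring_1"
  shows "(A + B) ^ (2 * m + 1) - (A - B) ^ (2 * m + 1) = 2 * B * odd_binom m (A\<^sup>2) (B\<^sup>2)"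
proof -
  let ?n = "2 * m + 1"
  \<comment> \<open>With \<open>B\<close> as first summand the index counts the powers of
    \<open>B\<close>; the even ones cancel in the difference.\<close>
  have "(A + B) ^ ?n - (A - B) ^ ?n =
      (B + A) ^ ?n - (- B + A) ^ ?n" by (simp add: add.commute)
  also have "\<dots> = (\<Sum>i\<le>?n. of_nat (?n choose i) * B ^ i * A ^ (?n - i))
      - (\<Sum>i\<le>?n. of_nat (?n choose i) * (- B) ^ i * A ^ (?n - i))"
    by (simp only: binomial_ring)
  also have "\<dots> = (\<Sum>i<2 * Suc m. if even i then 0 else 2 * (of_nat (?n choose i) * B ^ i * A ^ (?n - i)))"
    unfolding sum_subtractf[symmetric]
    by (rule sum.cong) (auto simp: lessThan_Suc_atMost)
  also have "\<dots> = (\<Sum>k<Suc m. 2 * (of_nat (?n choose (2 * k + 1)) * B ^ (2 * k + 1) * A ^ (?n - (2 * k + 1))))"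
    by (rule sum_odd_indices)
  also have "\<dots> = 2 * B * odd_binom m (A\<^sup>2) (B\<^sup>2)"
    unfolding odd_binom_def sum_distrib_left
    by (rule sum.cong) (auto simp: power_mult[symmetric] algebra_simps diff_mult_distrib2)
  finally show ?thesis .
qed

lemma of_int_odd_binom: "of_int (odd_binom m w u) = odd_binom m (of_int w) (of_int u)"
  by (simp add: odd_binom_def)

text \<open>All coefficients are nonnegative, so the value is at least the one on the diagonal
  \<open>w = u = c\<close>, which homogeneity reduces to \<open>A = B = 1\<close>.\<close>

lemma odd_binom_ge:
  fixes u w :: int
  assumes "0 \<le> c" "c \<le> u" "c \<le> w"
  shows "4 ^ m * c ^ m \<le> odd_binom m w u"
proof -
  have "odd_binom m c c = 4 ^ m * c ^ m"
  proof -
    have "2 * odd_binom m 1 (1::int) = 2 ^ (2 * m + 1)"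
      using odd_binom_diff[of "1::int" 1 m] by simp
    hence "odd_binom m 1 (1::int) = 4 ^ m" by (simp add: power_mult)
    moreover have "odd_binom m c c = c ^ m * odd_binom m 1 1"
      unfolding odd_binom_def sum_distrib_left
      by (rule sum.cong) (auto simp: power_add[symmetric])
    ultimately show ?thesis by simp
  qed
  moreover have "odd_binom m c c \<le> odd_binom m w u"
    unfolding odd_binom_def using assms
    by (intro sum_mono mult_mono power_mono) auto
  ultimately show ?thesis by simp
qed

text \<open>Only the summand with \<open>k = 0\<close> is free of the factor
  \<open>u\<close>.\<close>

lemma odd_binom_mod:
  fixes q :: int
  assumes "q dvd u"
  shows "q dvd odd_binom m w u - (2 * int m + 1) * w ^ m"
proof -
  have "odd_binom m w u - (2 * int m + 1) * w ^ m =
      (\<Sum>k<m. of_nat ((2 * m + 1) choose (2 * Suc k + 1)) * w ^ (m - Suc k) * u ^ Suc k)"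
    unfolding odd_binom_def by (subst sum.lessThan_Suc_shift) simp
  also have "q dvd \<dots>" using assms by (intro dvd_sum) auto
  finally show ?thesis .
qed

section \<open>Lifting the exponent and divisibility of the index\<close>

text \<open>Bounds the exponent of a prime \<open>q \<ge> 5\<close> in the denominator
  \<open>2 * k + 1\<close>. With 3 in place of 5 this already fails at \<open>f = k = 1\<close>,
  which is why the prime 3 needs a separate argument.\<close>

lemma five_power_le_imp: "5 ^ f \<le> 2 * k + (1::nat) \<Longrightarrow> k > 0 \<Longrightarrow> f < k"
proof (rule ccontr)
  assume "5 ^ f \<le> 2 * k + (1::nat)" "k > 0" "\<not> f < k"
  moreover have "2 * f + 1 < (5::nat) ^ f" if "f > 0" for f
    using that by (induction f rule: nat_induct_non_zero) auto
  ultimately show False by (metis add_le_mono1 linorder_not_le mult_le_mono2 order_less_le_trans gr_zeroI le_zero_eq)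
qed

text \<open>Lifting the exponent: the binomial coefficients supply the factor \<open>2 * m + 1\<close>,
  up to the denominators \<open>2 * k + 1\<close>, which \<open>u ^ k\<close> absorbs for \<open>q \<ge> 5\<close>.\<close>

lemma odd_binom_prime_power_dvd:
  fixes q :: int
  assumes q: "prime q" "q \<ge> 5" and "q dvd u" "\<not> q dvd w" and "q ^ j dvd odd_binom m w u"
  shows "q ^ j dvd 2 * int m + 1"
proof (rule ccontr)
  assume neg: "\<not> q ^ j dvd 2 * int m + 1"
  define n where "n = 2 * int m + 1"
  define e where "e = multiplicity q n"
  have n0: "n \<noteq> 0" by (simp add: n_def)
  have qe: "q ^ e dvd n" unfolding e_def by (rule multiplicity_dvd)
  have "j > e" using neg qe n_def by (meson dvd_trans le_imp_power_dvd linorder_not_le)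
  hence G: "q ^ Suc e dvd odd_binom m w u"
    using assms(5) by (meson Suc_leI dvd_trans le_imp_power_dvd)
  \<comment> \<open>Every summand after the first gains at least one factor \<open>q\<close> beyond
    \<open>q ^ e\<close>; then \<open>q ^ Suc e\<close> divides the first summand too, against the
    choice of \<open>e\<close>.\<close>
  have summand: "q ^ Suc e dvd int ((2 * m + 1) choose (2 * Suc k + 1)) * u ^ Suc k" for k
  proof -
    define r where "r = 2 * int (Suc k) + 1"
    define C where "C = int ((2 * m + 1) choose (2 * Suc k + 1)) * u ^ Suc k"
    define f where "f = multiplicity q r"
    have r0: "r \<noteq> 0" "r > 0" by (auto simp: r_def)
    obtain r' where r': "r = q ^ f * r'" "\<not> q dvd r'"
      using multiplicity_decompose'[of r q] r0 q f_def
      by (metis not_prime_unit)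
    have "q ^ f \<le> r" using r'(1) r0 by (intro zdvd_imp_le) auto
    moreover have "5 ^ f \<le> q ^ f" using q by (intro power_mono) auto
    ultimately have "int (5 ^ f) \<le> int (2 * Suc k + 1)" by (simp add: r_def)
    hence "5 ^ f \<le> 2 * Suc k + 1" by (simp only: of_nat_le_iff)
    hence f: "f < Suc k" by (rule five_power_le_imp) simp
    \<comment> \<open>Absorption exposes the factor \<open>n = 2 * m + 1\<close> at the cost of the
      denominator \<open>r\<close>. Its \<open>q\<close>-part \<open>q ^ f\<close> has
      \<open>f < Suc k\<close>, so \<open>u ^ Suc k\<close> outweighs it.\<close>
    have "(2 * Suc k + 1) * ((2 * m + 1) choose (2 * Suc k + 1)) = (2 * m + 1) * ((2 * m) choose (2 * Suc k))"
      using binomial_absorption[of "2 * Suc k" "2*m+1"] by simp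
    hence "int (2 * Suc k + 1) * int ((2 * m + 1) choose (2 * Suc k + 1)) = int (2 * m + 1) * int ((2 * m) choose (2 * Suc k))"
      by (simp only: of_nat_mult[symmetric])
    hence "r * int ((2 * m + 1) choose (2 * Suc k + 1)) = n * int ((2 * m) choose (2 * Suc k))"
      unfolding r_def n_def by (simp only: of_nat_add of_nat_mult of_nat_1 of_nat_numeral)
    hence "r * C = n * int ((2 * m) choose (2 * Suc k)) * u ^ Suc k"
      unfolding C_def by (simp only: mult.assoc[symmetric])
    moreover have "q ^ e * q ^ Suc k dvd n * int ((2 * m) choose (2 * Suc k)) * u ^ Suc k"
      using qe \<open>q dvd u\<close> by (intro mult_dvd_mono dvd_power_same) auto
    ultimately have "q ^ (e + Suc k) dvd r' * (q ^ f * C)"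
      using r' by (simp add: power_add mult.commute mult.left_commute)
    moreover have "coprime (q ^ (e + Suc k)) r'"
      using r' q prime_imp_coprime by auto
    ultimately have "q ^ (e + Suc k) dvd q ^ f * C"
      using coprime_dvd_mult_right_iff by blast
    moreover have "q ^ (e + Suc k) = q ^ f * q ^ (e + Suc k - f)"
      using f by (simp add: power_add[symmetric])
    ultimately have "q ^ (e + Suc k - f) dvd C" using q by auto
    thus ?thesis unfolding C_def
      using f by (elim dvd_trans[rotated]) (intro le_imp_power_dvd, simp)
  qed
  have "odd_binom m w u - n * w ^ m =
      (\<Sum>k<m. (int ((2 * m + 1) choose (2 * Suc k + 1)) * u ^ Suc k) * w ^ (m - Suc k))"
    unfolding odd_binom_def n_def by (subst sum.lessThan_Suc_shift) (simp add: mult_ac)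
  also have "q ^ Suc e dvd \<dots>" by (intro dvd_sum dvd_mult2 summand)
  finally have "q ^ Suc e dvd n * w ^ m" using G by (metis dvd_diff_commute dvd_diffD1 dvd_diff_right_iff)
  moreover have "coprime (q ^ Suc e) (w ^ m)"
    using assms by (simp add: prime_imp_coprime)
  ultimately have "q ^ Suc e dvd n" using coprime_dvd_mult_left_iff by blast
  thus False using n0 q unfolding e_def
    by (metis multiplicity_lessI lessI not_prime_unit power_dvd_iff_le_multiplicity not_less_eq_eq order_refl)
qed

text \<open>The cube of \<open>(A + B) / 2\<close> is \<open>b * A + a * B\<close> with integers
  \<open>a\<close>, \<open>b\<close>, without any denominator. If 3 divides the exponent, the power
  is one of this cube, and taking the difference of conjugates produces an extra factor 2 in
  \<open>M\<close>. This generalizes the fact that every third Fibonacci number is even.\<close>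

lemma odd_binom_odd_not_three_dvd:
  fixes u w M \<epsilon> :: int
  assumes pos: "u > 0" "w > 0" and "odd w" and "\<epsilon> = 1 \<or> \<epsilon> = -1" and uw: "u - w = 4 * \<epsilon>"
    and M: "4 ^ m * M = odd_binom m w u" and "odd M"
  shows "\<not> 3 dvd 2 * m + 1"
proof
  assume "3 dvd 2 * m + 1"
  then obtain l where l: "2 * m + 1 = 3 * l" by blast
  have "odd l" using l by presburger
  then obtain t where t: "l = 2 * t + 1" by (rule oddE)
  have "even (w + \<epsilon>)" using assms(3,4) by auto
  moreover have "even (u - \<epsilon>)" using assms(3,4) uw by presburger
  ultimately
  obtain a b where a: "w + \<epsilon> = 2 * a" and b: "u - \<epsilon> = 2 * b" by (metis evenE)
  have a8: "u + 3 * w = 8 * a" and b8: "3 * u + w = 8 * b" using a b uw by auto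
  define A B where "A = sqrt (real_of_int w)" and "B = sqrt (real_of_int u)"
  have sq: "A\<^sup>2 = w" "B\<^sup>2 = u" using pos by (auto simp: A_def B_def)
  have B0: "B \<noteq> 0" using pos by (auto simp: B_def)
  have c1: "(A + B) ^ 3 = 8 * (b * A + a * B)" "(A - B) ^ 3 = 8 * (b * A - a * B)"
  proof -
    have "(A + B) ^ 3 = A * (A\<^sup>2 + 3 * B\<^sup>2) + B * (B\<^sup>2 + 3 * A\<^sup>2)"
      "(A - B) ^ 3 = A * (A\<^sup>2 + 3 * B\<^sup>2) - B * (B\<^sup>2 + 3 * A\<^sup>2)"
      by (auto simp: power2_eq_square power3_eq_cube algebra_simps)
    moreover have "A\<^sup>2 + 3 * B\<^sup>2 = 8 * b" "B\<^sup>2 + 3 * A\<^sup>2 = 8 * a"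
      unfolding sq using a8 b8 by linarith+
    ultimately show "(A + B) ^ 3 = 8 * (b * A + a * B)" "(A - B) ^ 3 = 8 * (b * A - a * B)"
      by (simp_all add: algebra_simps)
  qed
  have "2 * B * odd_binom m (A\<^sup>2) (B\<^sup>2) = (A + B) ^ (3 * l) - (A - B) ^ (3 * l)"
    unfolding l[symmetric] by (rule odd_binom_diff[symmetric])
  also have "\<dots> = 8 ^ l * ((b * A + a * B) ^ l - (b * A - a * B) ^ l)"
    unfolding power_mult c1 power_mult_distrib[of 8] by (simp only: right_diff_distrib)
  also have "\<dots> = 8 ^ l * (2 * (a * B) * odd_binom t ((b * A)\<^sup>2) ((a * B)\<^sup>2))"
    unfolding t by (simp only: odd_binom_diff)
  also have "\<dots> = 2 * B * (8 ^ l * a * odd_binom t (real_of_int (b\<^sup>2 * w)) (real_of_int (a\<^sup>2 * u)))"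
    by (simp add: power_mult_distrib sq)
  finally have "odd_binom m (A\<^sup>2) (B\<^sup>2) = 8 ^ l * a * odd_binom t (real_of_int (b\<^sup>2 * w)) (real_of_int (a\<^sup>2 * u))"
    using B0 by simp
  hence "real_of_int (odd_binom m w u) = real_of_int (8 ^ l * a * odd_binom t (b\<^sup>2 * w) (a\<^sup>2 * u))"
    by (simp add: sq of_int_odd_binom)
  hence "4 ^ m * M = 8 ^ l * a * odd_binom t (b\<^sup>2 * w) (a\<^sup>2 * u)"
    unfolding M by (simp only: of_int_eq_iff)
  also have "(8::int) ^ l = 2 ^ (3 * l)" by (simp add: power_mult)
  \<comment> \<open>The surplus factor 2 over \<open>4 ^ m\<close> is what makes \<open>M\<close>
    even.\<close>
  also have "\<dots> = 4 ^ m * 2" unfolding l[symmetric] by (simp add: power_mult)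
  finally have "M = 2 * (a * odd_binom t (b\<^sup>2 * w) (a\<^sup>2 * u))" by simp
  with \<open>odd M\<close> show False by simp
qed

lemma dvd_of_prime_powers:
  fixes M n :: int
  assumes "M \<noteq> 0" "n \<noteq> 0" "\<And>q j. prime q \<Longrightarrow> j > 0 \<Longrightarrow> q ^ j dvd M \<Longrightarrow> q ^ j dvd n"
  shows "M dvd n"
proof (rule multiplicity_le_imp_dvd)
  fix q :: int assume q: "prime q"
  show "multiplicity q M \<le> multiplicity q n"
  proof (cases "multiplicity q M = 0")
    case False
    hence "q ^ multiplicity q M dvd n" using assms(3)[OF q, of "multiplicity q M"] multiplicity_dvd by auto
    thus ?thesis using assms(2) q by (intro multiplicity_geI) (auto simp: not_prime_unit)
  qed simp
qed (use assms in auto)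

text \<open>A prime \<open>q\<close> dividing \<open>M\<close> is odd and divides \<open>u\<close>,
  hence not \<open>w\<close>, as \<open>u - w\<close> is 4 or -4. Reduction modulo \<open>q\<close>
  gives \<open>q dvd 2 * m + 1\<close>, so \<open>q\<close> is not 3, and lifting the exponent
  applies to each power of \<open>q\<close> in \<open>M\<close>.\<close>

lemma odd_binom_dvd_index:
  fixes u w M \<epsilon> :: int
  assumes pos: "u > 0" "w > 0" and "odd w" and "\<epsilon> = 1 \<or> \<epsilon> = -1" and uw: "u - w = 4 * \<epsilon>"
    and M: "4 ^ m * M = odd_binom m w u" and "odd M"
    and rad: "\<And>q. prime q \<Longrightarrow> q dvd M \<Longrightarrow> q dvd u"
  shows "M dvd 2 * int m + 1"
proof (rule dvd_of_prime_powers)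
  show "M \<noteq> 0" using \<open>odd M\<close> by auto
  show "2 * int m + 1 \<noteq> 0" by simp
  fix q :: int and j :: nat assume q: "prime q" "j > 0" "q ^ j dvd M"
  have qM: "q dvd M" using q by (meson dvd_power dvd_trans)
  have "odd q" using qM \<open>odd M\<close> dvd_trans by blast
  have qu: "q dvd u" using rad q qM by blast
  have qw: "\<not> q dvd w"
  proof
    assume "q dvd w"
    hence "q dvd 4 * \<epsilon>" using qu uw by (metis dvd_diff)
    hence "q dvd 2 ^ 2" using assms(4) by auto
    hence "q dvd 2" using q prime_dvd_power by blast
    thus False using \<open>odd q\<close> q by (metis primes_dvd_imp_eq two_is_prime dvd_refl)
  qed
  have qG: "q ^ j dvd odd_binom m w u" unfolding M[symmetric] using q by simp
  hence "q dvd odd_binom m w u" using q by (meson dvd_power dvd_trans)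
  hence "q dvd (2 * int m + 1) * w ^ m"
    using odd_binom_mod[OF qu, of m w] by (metis dvd_diff_commute dvd_diffD1 dvd_diff_right_iff)
  hence "q dvd 2 * int m + 1" using qw q by (metis prime_dvd_mult_iff prime_dvd_power)
  moreover have "\<not> 3 dvd 2 * int m + 1"
  proof
    assume "3 dvd 2 * int m + 1"
    hence "int 3 dvd int (2 * m + 1)" by (simp add: add.commute)
    hence "3 dvd 2 * m + 1" by (simp only: of_nat_dvd_iff)
    thus False using odd_binom_odd_not_three_dvd[OF assms(1-7)] by blast
  qed
  ultimately have "q \<noteq> 3" by auto
  moreover have "q \<ge> 2" using q by (simp add: prime_ge_2_int)
  ultimately have "q \<ge> 5" using \<open>odd q\<close> by presburger
  thus "q ^ j dvd 2 * int m + 1" using odd_binom_prime_power_dvd q qu qw qG by blast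
qed

section \<open>Exponential growth against divisibility of the index\<close>

lemma three_power_le: "(3::int) ^ m \<le> 2 * int m + 1 \<Longrightarrow> m \<le> 1"
proof (rule ccontr)
  assume "(3::int) ^ m \<le> 2 * int m + 1" "\<not> m \<le> 1"
  moreover have "2 * int m + 1 < 3 ^ m" if "m \<ge> 2" for m
    using that by (induction m rule: dec_induct) auto
  ultimately show False by (metis not_less_eq_eq not_le One_nat_def Suc_1)
qed

text \<open>The exceptional solution comes from the Fibonacci number \<open>F\<^sub>5 = 5\<close>, the case \<open>u = 5\<close>, \<open>w = 1\<close>.\<close>

lemma odd_binom_radical:
  fixes u w M \<epsilon> :: int
  assumes pos: "u \<ge> 3" "w > 0" and "odd w" and "\<epsilon> = 1 \<or> \<epsilon> = -1" and uw: "u - w = 4 * \<epsilon>"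
    and M: "4 ^ m * M = odd_binom m w u" and "odd M"
    and rad: "\<And>q. prime q \<Longrightarrow> q dvd M \<Longrightarrow> q dvd u"
  shows "m = 0 \<or> m = 2 \<and> u = 5 \<and> w = 1 \<and> M = 5 \<and> \<epsilon> = 1"
proof -
  have u0: "u > 0" using pos by simp
  have not3: "\<not> 3 dvd 2 * m + 1"
    using odd_binom_odd_not_three_dvd[OF u0 assms(2-7)] by blast
  hence m1: "m \<noteq> 1" by auto
  have "M dvd 2 * int m + 1" using odd_binom_dvd_index[OF u0 assms(2-7) rad] .
  hence le: "M \<le> 2 * int m + 1" by (intro zdvd_imp_le) auto
  show ?thesis
  proof (cases "w \<ge> 3")
    case True
    \<comment> \<open>Both arguments are at least 3, so \<open>M \<ge> 3 ^ m\<close>, while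
      \<open>M\<close> is at most \<open>2 * m + 1\<close>.\<close>
    have "4 ^ m * 3 ^ m \<le> 4 ^ m * M" unfolding M using True pos by (intro odd_binom_ge) auto
    hence "3 ^ m \<le> M" by simp
    hence "m \<le> 1" using le three_power_le by force
    thus ?thesis using m1 by auto
  next
    case False
    hence w: "w = 1" using pos \<open>odd w\<close> by presburger
    hence u: "u = 5" "\<epsilon> = 1" using uw pos assms(4) by auto
    have "m < 3"
    proof (rule ccontr)
      assume "\<not> m < 3"
      hence m3: "m \<ge> 3" by simp
      \<comment> \<open>For \<open>w = 1\<close> the diagonal bound gives only
        \<open>M \<ge> 1\<close>. The single summand \<open>k = m - 1\<close>, equal to
        \<open>(2 * m + 1) * m * 5 ^ (m - 1)\<close>, is already too large once
        \<open>m \<ge> 3\<close>.\<close>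
      have "int ((2 * m + 1) choose (2 * (m - 1) + 1)) * 1 ^ (m - (m - 1)) * 5 ^ (m - 1) \<le> odd_binom m w u"
        unfolding odd_binom_def w u using m3 by (intro member_le_sum) auto
      moreover have "(2 * m + 1) choose (2 * (m - 1) + 1) = (2 * m + 1) * m"
      proof -
        have "2 * m + 1 - (2 * (m - 1) + 1) = 2" using m3 by simp
        hence "(2 * m + 1) choose (2 * (m - 1) + 1) = (2 * m + 1) choose 2"
          using m3 by (metis binomial_symmetric add_le_mono1 diff_le_self mult_le_mono2)
        thus ?thesis by (simp add: choose_two)
      qed
      ultimately have "int ((2 * m + 1) * m) * 5 ^ (m - 1) \<le> 4 ^ m * M" using M by (simp only: power_one mult_1_right)
      also have "\<dots> \<le> 4 ^ m * (2 * int m + 1)" using le by simp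
      finally have "(2 * int m + 1) * (int m * 5 ^ (m - 1)) \<le> (2 * int m + 1) * 4 ^ m"
        by (simp add: algebra_simps)
      hence "int m * 5 ^ (m - 1) \<le> 4 ^ m" by simp
      moreover have "4 ^ m < int m * 5 ^ (m - 1)"
        using m3
      proof (induction m rule: dec_induct)
        case (step n)
        have "(5::int) ^ n = 5 * 5 ^ (n - 1)" using step by (cases n) auto
        hence "int (Suc n) * 5 ^ (Suc n - 1) \<ge> 5 * (int n * 5 ^ (n - 1))" by (simp add: algebra_simps)
        moreover have "(0::int) < 4 ^ n" by simp
        ultimately have "4 * 4 ^ n < int (Suc n) * 5 ^ (Suc n - 1)" using step.IH by linarith
        thus ?case by simp
      qed simp
      ultimately show False by simp
    qed
    hence "m = 0 \<or> m = 2" using m1 by auto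
    \<comment> \<open>The sum is \<open>5 + 50 + 25 = 80 = 4\<^sup>2 * 5\<close>.\<close>
    moreover have "M = 5" if "m = 2"
      using M unfolding that w u odd_binom_def by (simp add: lessThan_Suc eval_nat_numeral binomial_Suc_Suc)
    ultimately show ?thesis using u w by auto
  qed
qed

section \<open>Fundamental unit and descent\<close>

text \<open>The right-hand side is \<open>f\<^sup>2 - 4 * \<epsilon> * N * e\<^sup>2 + 4\<close>
  with \<open>f = N * y * e\<close>. Since \<open>\<bar>Z\<bar>\<close> and \<open>f\<close> are
  distinct and of equal parity, they differ by at least 2; comparing squares gives
  \<open>f \<le> N * e\<^sup>2\<close>. This shows that \<open>y\<close> is the least positive
  coefficient, the minimality that the descent requires.\<close>

lemma unit_coefficient_ge:
  fixes N y \<epsilon> e Z :: int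
  assumes "odd N" "N > 0" "odd y" "y > 0" "e > 0" "\<epsilon> = 1 \<or> \<epsilon> = -1"
    and "N * e > 1"
    and Z: "Z\<^sup>2 = N * (N * y\<^sup>2 - 4 * \<epsilon>) * e\<^sup>2 + 4"
  shows "y \<le> e"
proof -
  define z where "z = \<bar>Z\<bar>"
  define f where "f = N * y * e"
  have z0: "z \<ge> 0" by (simp add: z_def)
  have zf: "z\<^sup>2 = f\<^sup>2 - 4 * \<epsilon> * (N * e\<^sup>2) + 4"
    using Z by (simp add: z_def f_def algebra_simps power2_eq_square)
  have "even (z\<^sup>2) \<longleftrightarrow> even (f\<^sup>2)" unfolding zf by simp
  hence par: "even (z - f)" by simp
  have Ne: "N * e\<^sup>2 > 1"
  proof -
    have "N * e * 1 \<le> N * e * e" using assms by (intro mult_left_mono) auto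
    thus ?thesis using assms(7) by (simp add: power2_eq_square mult.assoc)
  qed
  have f0: "f > 0" using assms by (simp add: f_def)
  have "f \<le> N * e\<^sup>2"
  proof (cases "\<epsilon> = 1")
    case True
    hence "z\<^sup>2 < f\<^sup>2" using zf Ne by simp
    hence "z < f" using f0 by (metis power2_less_imp_less less_imp_le)
    hence "z \<le> f - 2" using par by presburger
    hence "z\<^sup>2 \<le> (f - 2)\<^sup>2" using z0 by (intro power_mono) auto
    thus ?thesis using zf True by (simp add: power2_eq_square algebra_simps)
  next
    case False
    hence eps: "\<epsilon> = -1" using assms by auto
    hence "f\<^sup>2 < z\<^sup>2" using zf Ne by simp
    hence "f < z" using z0 by (metis power2_less_imp_less)
    hence "f + 2 \<le> z" using par by presburger
    hence "(f + 2)\<^sup>2 \<le> z\<^sup>2" using f0 by (intro power_mono) auto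
    thus ?thesis using zf eps by (simp add: power2_eq_square algebra_simps)
  qed
  thus ?thesis using assms by (simp add: f_def power2_eq_square)
qed

text \<open>Descent by the unit \<open>(E + y \<surd>(cd)) / 2\<close>, which preserves the class \<open>(c, d)\<close>.
  The hypothesis \<open>min\<close> says that this unit is the fundamental one; applied to \<open>X * Y\<close>,
  the coefficient in the square of \<open>(X \<surd>c + Y \<surd>d) / 2\<close>, it forces the descent to stop exactly
  at \<open>X * Y = 0\<close> or \<open>X * Y = y\<close>.\<close>

lemma orbit_representative:
  fixes c d y E X Y \<sigma> :: int and C D :: real
  assumes odds: "odd c" "odd d" "odd y" "odd E" and pos: "c > 0" "d > 0" "y > 0" "E > 2"
    and E: "E\<^sup>2 = c * d * y\<^sup>2 + 4" and \<sigma>: "\<sigma> = 1 \<or> \<sigma> = -1"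
    and min: "\<And>e Z. e > 0 \<Longrightarrow> Z\<^sup>2 = c * d * e\<^sup>2 + 4 \<Longrightarrow> y \<le> e"
    and XY: "c * X\<^sup>2 - d * Y\<^sup>2 = 4 * \<sigma>" "X \<ge> 0" "Y \<ge> 0"
  defines "C \<equiv> sqrt (real_of_int c)" and "D \<equiv> sqrt (real_of_int d)"
  obtains n X0 Y0 where "c * X0\<^sup>2 - d * Y0\<^sup>2 = 4 * \<sigma>" "X0 \<ge> 0" "Y0 \<ge> 0" "X0 * Y0 = 0 \<or> X0 * Y0 = y"
    "2 ^ n * (X * C + Y * D) = (X0 * C + Y0 * D) * (E + y * C * D) ^ n"
    "2 ^ n * (X * C - Y * D) = (X0 * C - Y0 * D) * (E - y * C * D) ^ n"
proof -
  \<comment> \<open>\<open>S\<close> collects the desired conclusions as a predicate of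
    \<open>X\<close> and \<open>Y\<close>, so that the induction can vary them. The powers of 2
    clear the denominators of the unit.\<close>
  define S where "S n X0 Y0 X Y \<longleftrightarrow> c * X0\<^sup>2 - d * Y0\<^sup>2 = 4 * \<sigma> \<and> X0 \<ge> 0 \<and> Y0 \<ge> 0 \<and> (X0 * Y0 = 0 \<or> X0 * Y0 = y) \<and>
    2 ^ n * (X * C + Y * D) = (X0 * C + Y0 * D) * (E + y * C * D) ^ n \<and>
    2 ^ n * (X * C - Y * D) = (X0 * C - Y0 * D) * (E - y * C * D) ^ n" for n and X0 Y0 X Y :: int
  have sq: "C * C = c" "D * D = d" using pos by (auto simp: C_def D_def)
  have "\<exists>n X0 Y0. S n X0 Y0 X Y"
    using XY
  proof (induction "nat (X * Y)" arbitrary: X Y rule: less_induct)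
    case less
    \<comment> \<open>The square of \<open>(X * C + Y * D) / 2\<close> is
      \<open>(Z + e * C * D) / 2\<close>.\<close>
    define e Z where "e = X * Y" and "Z = (c * X\<^sup>2 + d * Y\<^sup>2) div 2"
    have "even (c * X\<^sup>2 - d * Y\<^sup>2)" unfolding less.prems(1) by simp
    hence "even (c * X\<^sup>2 + d * Y\<^sup>2)" by simp
    hence Z2: "2 * Z = c * X\<^sup>2 + d * Y\<^sup>2" by (simp add: Z_def)
    have Z: "Z\<^sup>2 = c * d * e\<^sup>2 + 4"
    proof -
      have "(2 * Z)\<^sup>2 = (c * X\<^sup>2 - d * Y\<^sup>2)\<^sup>2 + 4 * (c * d * e\<^sup>2)"
        unfolding Z2 e_def by (simp add: power2_eq_square algebra_simps)
      also have "(c * X\<^sup>2 - d * Y\<^sup>2)\<^sup>2 = 16" using less.prems(1) \<sigma> by auto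
      finally show ?thesis by simp
    qed
    have "Z \<ge> 0" using Z2 pos by (smt (verit) mult_nonneg_nonneg zero_le_power2)
    have e0: "e \<ge> 0" using less.prems by (simp add: e_def)
    show ?case
    proof (cases "e \<le> y")
      case True
      hence "e = 0 \<or> e = y" using min[OF _ Z] e0 by force
      hence "S 0 X Y X Y" using less.prems by (simp add: S_def e_def)
      thus ?thesis by blast
    next
      case False
      hence ey: "e > y" by simp
      \<comment> \<open>\<open>Z'\<close> and \<open>e'\<close> are the coefficients of
        \<open>(Z + e * C * D) / 2\<close> divided by the unit. The bounds on them follow by
        comparing squares: \<open>k1\<close> for the sign of \<open>e'\<close>, \<open>k2\<close>
        for that of \<open>Z'\<close>, and \<open>k3\<close> for \<open>e' < e\<close>.\<close>
      have step: "\<exists>e' Z'. 2 * e' = E * e - y * Z \<and> 2 * Z' = E * Z - c * d * y * e \<and> Z'\<^sup>2 = c * d * e'\<^sup>2 + 4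
          \<and> Z' \<ge> 0 \<and> (e \<ge> y \<longrightarrow> e' \<ge> 0) \<and> (e > y \<longrightarrow> e' > 0) \<and> (e > 0 \<longrightarrow> e' < e)"
        if Z: "Z\<^sup>2 = c * d * e\<^sup>2 + 4" "Z \<ge> 0" "e \<ge> 0" for e Z
      proof -
        have "even (Z\<^sup>2) \<longleftrightarrow> even (e\<^sup>2)" unfolding Z using odds by simp
        hence "even Z \<longleftrightarrow> even e" by simp
        hence "even (E * e - y * Z)" "even (E * Z - c * d * y * e)" using odds by auto
        then obtain e' Z' where e': "E * e - y * Z = 2 * e'" and Z': "E * Z - c * d * y * e = 2 * Z'"
          by (metis evenE)
        have "(2 * Z')\<^sup>2 - c * d * (2 * e')\<^sup>2 = (E\<^sup>2 - c * d * y\<^sup>2) * (Z\<^sup>2 - c * d * e\<^sup>2)"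
          unfolding e'[symmetric] Z'[symmetric] by (simp add: power2_eq_square algebra_simps)
        also have "\<dots> = 16" using E Z by simp
        finally have n: "Z'\<^sup>2 = c * d * e'\<^sup>2 + 4" by simp
        have k1: "(E * e)\<^sup>2 - (y * Z)\<^sup>2 = 4 * (e\<^sup>2 - y\<^sup>2)"
          unfolding power_mult_distrib E Z by (simp add: algebra_simps)
        have k2: "(E * Z)\<^sup>2 - (c * d * y * e)\<^sup>2 = 4 * E\<^sup>2 + 4 * (c * d * e\<^sup>2)"
          unfolding power_mult_distrib E Z by (simp add: power2_eq_square algebra_simps)
        have k3: "(y * Z)\<^sup>2 - ((E - 2) * e)\<^sup>2 = 4 * y\<^sup>2 + 4 * (E - 2) * e\<^sup>2"
        proof -
          have "(y * Z)\<^sup>2 = (E\<^sup>2 - 4) * e\<^sup>2 + 4 * y\<^sup>2"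
            unfolding power_mult_distrib E Z by (simp add: algebra_simps)
          thus ?thesis by (simp add: power2_eq_square algebra_simps)
        qed
        have "c * d * y * e \<le> E * Z"
        proof (rule power2_le_imp_le)
          show "(c * d * y * e)\<^sup>2 \<le> (E * Z)\<^sup>2" using k2 pos by (smt (verit) mult_nonneg_nonneg zero_le_power2)
        qed (use pos Z in auto)
        moreover have "y * Z \<le> E * e" if "e \<ge> y"
        proof (rule power2_le_imp_le)
          have "y\<^sup>2 \<le> e\<^sup>2" using that pos by (intro power_mono) auto
          thus "(y * Z)\<^sup>2 \<le> (E * e)\<^sup>2" using k1 by simp
        qed (use pos Z in auto)
        moreover have "y * Z < E * e" if "e > y"
        proof (rule power2_less_imp_less)
          have "y\<^sup>2 < e\<^sup>2" using that pos by (intro power_strict_mono) auto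
          thus "(y * Z)\<^sup>2 < (E * e)\<^sup>2" using k1 by simp
        qed (use pos Z in auto)
        moreover have "(E - 2) * e < y * Z"
        proof (rule power2_less_imp_less)
          have "y\<^sup>2 > 0" "(E - 2) * e\<^sup>2 \<ge> 0" using pos by auto
          thus "((E - 2) * e)\<^sup>2 < (y * Z)\<^sup>2" using k3 by linarith
        qed (use pos Z in auto)
        ultimately show ?thesis using e' Z' n
          by (intro exI[of _ e'] exI[of _ Z']) (auto simp: algebra_simps)
      qed
      \<comment> \<open>Dividing \<open>X * C + Y * D\<close> by the unit divides its square by the
        unit squared, so \<open>step\<close> is used twice. Minimality gives
        \<open>e1 \<ge> y\<close>, which keeps the second coefficient nonnegative.\<close>
      obtain e1 Z1 where 1: "2 * e1 = E * e - y * Z" "2 * Z1 = E * Z - c * d * y * e"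
        "Z1\<^sup>2 = c * d * e1\<^sup>2 + 4" "Z1 \<ge> 0" "e1 > 0" "e1 < e"
        using step[OF Z \<open>Z \<ge> 0\<close> e0] ey pos by auto
      have "e1 \<ge> y" using min 1 by blast
      then obtain e2 where 2: "2 * e2 = E * e1 - y * Z1" "e2 \<ge> 0" "e2 < e1"
        using step[OF 1(3,4)] 1(5) by auto
      have "even (c * X\<^sup>2 - d * Y\<^sup>2)" unfolding less.prems(1) by simp
      hence "even X \<longleftrightarrow> even Y" using odds by simp
      hence "even (E * X - y * d * Y)" "even (E * Y - y * c * X)" using odds by auto
      \<comment> \<open>These are the coefficients of \<open>X * C + Y * D\<close> divided by the
        unit; their product turns out to be \<open>e2\<close>.\<close>
      then obtain X' Y' where X': "E * X - y * d * Y = 2 * X'" and Y': "E * Y - y * c * X = 2 * Y'"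
        by (metis evenE)
      have "c * (2 * X')\<^sup>2 - d * (2 * Y')\<^sup>2 = (E\<^sup>2 - c * d * y\<^sup>2) * (c * X\<^sup>2 - d * Y\<^sup>2)"
        unfolding X'[symmetric] Y'[symmetric] by (simp add: power2_eq_square algebra_simps)
      hence n': "c * X'\<^sup>2 - d * Y'\<^sup>2 = 4 * \<sigma>" using E less.prems(1) by simp
      have "4 * (X' * Y') = (E * X - y * d * Y) * (E * Y - y * c * X)"
        unfolding X' Y' by simp
      also have "\<dots> = (E\<^sup>2 + c * d * y\<^sup>2) * e - 2 * E * y * Z"
      proof -
        have "(E * X - y * d * Y) * (E * Y - y * c * X) = (E\<^sup>2 + c * d * y\<^sup>2) * e - E * y * (c * X\<^sup>2 + d * Y\<^sup>2)"
          unfolding e_def by (simp add: power2_eq_square algebra_simps)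
        thus ?thesis unfolding Z2[symmetric] by simp
      qed
      also have "\<dots> = E * (2 * e1) - y * (2 * Z1)"
        unfolding 1 by (simp add: power2_eq_square algebra_simps)
      also have "\<dots> = 4 * e2" using 2(1) by simp
      finally have e2: "X' * Y' = e2" by simp
      have lt: "nat (X' * Y') < nat (X * Y)" using e2 2 1 by (simp add: e_def)
      \<comment> \<open>The sign of \<open>\<sigma>\<close> decides which of \<open>X'\<close>,
        \<open>Y'\<close> is visibly positive; the nonnegative product then settles the
        other.\<close>
      have nonneg: "X' \<ge> 0 \<and> Y' \<ge> 0"
      proof -
        have "X' > 0 \<or> Y' > 0"
        proof (cases "\<sigma> = 1")
          case True
          have "y * d * Y < E * X"
          proof (rule power2_less_imp_less)
            have "(y * d * Y)\<^sup>2 = d * y\<^sup>2 * (d * Y\<^sup>2)" by (simp add: power2_eq_square algebra_simps)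
            also have "d * Y\<^sup>2 = c * X\<^sup>2 - 4" using less.prems(1) True by simp
            also have "d * y\<^sup>2 * (c * X\<^sup>2 - 4) = (E\<^sup>2 - 4) * X\<^sup>2 - 4 * d * y\<^sup>2" unfolding E by (simp add: algebra_simps)
            also have "\<dots> < E\<^sup>2 * X\<^sup>2"
            proof -
              have "4 * d * y\<^sup>2 > 0" "X\<^sup>2 \<ge> 0" using pos by auto
              thus ?thesis by (simp only: left_diff_distrib)
            qed
            finally show "(y * d * Y)\<^sup>2 < (E * X)\<^sup>2" by (simp add: power_mult_distrib)
          qed (use pos less.prems in auto)
          thus ?thesis using X' by simp
        next
          case False
          have "y * c * X < E * Y"
          proof (rule power2_less_imp_less)
            have "(y * c * X)\<^sup>2 = c * y\<^sup>2 * (c * X\<^sup>2)" by (simp add: power2_eq_square algebra_simps)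
            also have "c * X\<^sup>2 = d * Y\<^sup>2 - 4" using less.prems(1) False \<sigma> by simp
            also have "c * y\<^sup>2 * (d * Y\<^sup>2 - 4) = (E\<^sup>2 - 4) * Y\<^sup>2 - 4 * c * y\<^sup>2" unfolding E by (simp add: algebra_simps)
            also have "\<dots> < E\<^sup>2 * Y\<^sup>2"
            proof -
              have "4 * c * y\<^sup>2 > 0" "Y\<^sup>2 \<ge> 0" using pos by auto
              thus ?thesis by (simp only: left_diff_distrib)
            qed
            finally show "(y * c * X)\<^sup>2 < (E * Y)\<^sup>2" by (simp add: power_mult_distrib)
          qed (use pos less.prems in auto)
          thus ?thesis using Y' by simp
        qed
        moreover have "X' * Y' \<ge> 0" using e2 2 by simp
        ultimately show ?thesis by (auto simp: zero_le_mult_iff)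
      qed
      obtain n X0 Y0 where IH: "S n X0 Y0 X' Y'" using less.hyps[OF lt n'] nonneg by blast
      have rX: "E * X - y * d * Y = 2 * real_of_int X'" and rY: "E * Y - y * c * X = 2 * real_of_int Y'"
        using arg_cong[OF X', of real_of_int] arg_cong[OF Y', of real_of_int] by simp_all
      have fX: "E * X - y * (D * D) * Y = 2 * X'" and fY: "E * Y - y * (C * C) * X = 2 * Y'"
        unfolding sq using rX rY by simp_all
      have rE: "real_of_int E * E = c * d * y * y + 4"
        using arg_cong[OF E, of real_of_int] by (simp add: power2_eq_square)
      have unit: "(E + y * C * D) * (E - y * C * D) = (4 :: real)"
      proof -
        have "(E + y * C * D) * (E - y * C * D) = E * E - y * y * (C * C) * (D * D)"
          by (simp add: algebra_simps)
        also have "\<dots> = 4" unfolding sq using rE by (simp add: algebra_simps)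
        finally show ?thesis .
      qed
      have halve: "2 * Q = P * u" if "2 * P * u = Q * 4" for P Q u :: real using that by simp
      have "2 * (X' * C + Y' * D) = (X * C + Y * D) * (E - y * C * D)"
      proof -
        have "(X * C + Y * D) * (E - y * C * D) = (E * X - y * (D * D) * Y) * C + (E * Y - y * (C * C) * X) * D"
          by (simp add: algebra_simps)
        also have "\<dots> = 2 * (X' * C + Y' * D)" unfolding fX fY by (simp add: algebra_simps)
        finally show ?thesis by simp
      qed
      hence "2 * (X' * C + Y' * D) * (E + y * C * D) = (X * C + Y * D) * ((E + y * C * D) * (E - y * C * D))"
        by (simp only: mult_ac)
      hence up1: "2 * (X * C + Y * D) = (X' * C + Y' * D) * (E + y * C * D)" unfolding unit by (rule halve)
      have "2 * (X' * C - Y' * D) = (X * C - Y * D) * (E + y * C * D)"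
      proof -
        have "(X * C - Y * D) * (E + y * C * D) = (E * X - y * (D * D) * Y) * C - (E * Y - y * (C * C) * X) * D"
          by (simp add: algebra_simps)
        also have "\<dots> = 2 * (X' * C - Y' * D)" unfolding fX fY by (simp add: algebra_simps)
        finally show ?thesis by simp
      qed
      hence "2 * (X' * C - Y' * D) * (E - y * C * D) = (X * C - Y * D) * ((E + y * C * D) * (E - y * C * D))"
        by (simp only: mult_ac)
      hence up2: "2 * (X * C - Y * D) = (X' * C - Y' * D) * (E - y * C * D)" unfolding unit by (rule halve)
      have lift: "2 ^ Suc n * P = R * u ^ Suc n" if "2 * P = Q * u" "2 ^ n * Q = R * u ^ n" for P Q R u :: real
      proof -
        have "2 ^ Suc n * P = 2 ^ n * (2 * P)" by simp
        also have "\<dots> = (2 ^ n * Q) * u" unfolding that(1) by simp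
        finally show ?thesis unfolding that(2) by simp
      qed
      have "S (Suc n) X0 Y0 X Y"
        using IH lift[OF up1] lift[OF up2] unfolding S_def by blast
      thus ?thesis by blast
    qed
  qed
  then obtain n X0 Y0 where "S n X0 Y0 X Y" by blast
  thus ?thesis using that unfolding S_def by blast
qed

section \<open>Solutions given by powers of the unit and of its square root\<close>

lemma odd_dvd_four_imp_unit:
  fixes n :: int
  assumes "odd n" "n dvd 4" "n > 0"
  shows "n = 1"
proof -
  have "n \<le> 4" using assms zdvd_imp_le by fastforce
  hence "n = 1 \<or> n = 2 \<or> n = 3 \<or> n = 4" using assms(3) by auto
  thus ?thesis using assms by auto
qed

lemma coeff_dvd_of_odd_binom:
  fixes y B :: int
  assumes "odd y" and "4 ^ m * B = y * G"
  obtains M where "B = y * M" "4 ^ m * M = G"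
proof -
  have "coprime y (4 ^ m)"
  proof -
    have "coprime y (2 ^ 2)" using assms by (simp only: coprime_power_right_iff coprime_right_2_iff_odd) simp
    thus ?thesis by simp
  qed
  moreover have "y dvd 4 ^ m * B" using assms by simp
  ultimately have "y dvd B" using coprime_dvd_mult_right_iff by blast
  then obtain M where M: "B = y * M" by blast
  show ?thesis
    by (rule that[OF M]) (use M assms in \<open>auto simp: mult.left_commute\<close>)
qed

text \<open>In the square of \<open>E + y * s\<close> the coefficient of \<open>s\<close> is
  \<open>2 * E * y\<close>, and numbers of the form \<open>P + E * Q * s\<close> are closed under
  multiplication.\<close>

lemma power_even_conjugates:
  fixes E D2 :: int and y :: int and s :: real
  assumes "s * s = D2"
  shows "\<exists>(P :: int) (Q :: int). (E + y * s) ^ (2 * m) = P + E * Q * s \<and> (E - y * s) ^ (2 * m) = P - E * Q * s"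
proof (induction m)
  case 0
  show ?case by (rule exI[of _ 1], rule exI[of _ 0]) simp
next
  case (Suc m)
  then obtain P Q :: int where IH: "(E + y * s) ^ (2 * m) = P + E * Q * s" "(E - y * s) ^ (2 * m) = P - E * Q * s"
    by blast
  let ?a = "E\<^sup>2 + y\<^sup>2 * D2"
  have sq: "(E + y * s) ^ 2 = ?a + E * (2 * y) * s" "(E - y * s) ^ 2 = ?a - E * (2 * y) * s"
    using assms by (auto simp: power2_eq_square algebra_simps)
  have "(E + y * s) ^ (2 * Suc m) = (P + E * Q * s) * (?a + E * (2 * y) * s)"
    "(E - y * s) ^ (2 * Suc m) = (P - E * Q * s) * (?a - E * (2 * y) * s)"
    unfolding mult_Suc_right power_add IH sq by (simp_all only: mult.commute)
  hence "(E + y * s) ^ (2 * Suc m) = (P * ?a + E\<^sup>2 * Q * 2 * y * (s * s)) + E * (2 * y * P + Q * ?a) * s"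
    "(E - y * s) ^ (2 * Suc m) = (P * ?a + E\<^sup>2 * Q * 2 * y * (s * s)) - E * (2 * y * P + Q * ?a) * s"
    by (simp_all add: power2_eq_square algebra_simps)
  thus ?case unfolding assms
    by (intro exI[of _ "P * ?a + E\<^sup>2 * Q * 2 * y * D2"] exI[of _ "2 * y * P + Q * ?a"]) simp
qed

text \<open>For an even exponent \<open>E\<close> would divide \<open>B0\<close>, so a prime factor
  of \<open>E\<close> would divide \<open>V\<close> and hence \<open>2 * \<epsilon>\<close>,
  although \<open>E\<close> is odd. For an odd exponent \<open>odd_binom_radical\<close> leaves only
  the first power.\<close>

lemma solution_from_unit_power:
  fixes d y E A0 B0 V \<epsilon> :: int and D :: real
  assumes odds: "odd d" "odd y" "odd E" "odd B0" and pos: "d > 0" "y > 0" "E > 2" "B0 > 0"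
    and E: "E\<^sup>2 = d * y\<^sup>2 + 4" "E = V * y\<^sup>2 - 2 * \<epsilon>" "V dvd d" and \<epsilon>: "\<epsilon> = 1 \<or> \<epsilon> = -1"
    and rad: "\<And>q. prime q \<Longrightarrow> q dvd B0 \<Longrightarrow> q dvd V"
    and D: "D = sqrt (real_of_int d)"
    and p1: "2 ^ n * (A0 + B0 * D) = 2 * (E + y * D) ^ n"
    and p2: "2 ^ n * (A0 - B0 * D) = 2 * (E - y * D) ^ n"
  shows "A0 = E \<and> B0 = y"
proof -
  have D2: "D * D = d" "D \<noteq> 0" using pos by (auto simp: D)
  have diff: "2 ^ n * B0 * D * 2 = 2 * ((E + y * D) ^ n - (E - y * D) ^ n)"
    using p1 p2 by (simp add: algebra_simps)
  have "odd n"
  proof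
    assume "even n"
    then obtain m where n: "n = 2 * m" by blast
    obtain P Q :: int where PQ: "(E + y * D) ^ n = P + E * Q * D" "(E - y * D) ^ n = P - E * Q * D"
      using power_even_conjugates[OF D2(1)] n by metis
    have "2 ^ n * B0 * D = 2 * E * Q * D" using diff unfolding PQ by (simp add: algebra_simps)
    hence "real_of_int (2 ^ n * B0) = real_of_int (2 * E * Q)" using D2 by simp
    hence eq: "2 ^ n * B0 = 2 * E * Q" by (simp only: of_int_eq_iff)
    hence "E dvd 2 ^ n * B0" by simp
    moreover have "coprime E (2 ^ n)" using odds by simp
    ultimately have EB: "E dvd B0" using coprime_dvd_mult_right_iff by blast
    obtain q where q: "prime q" "q dvd E" using pos prime_divisor_exists[of E] by auto
    have "q dvd V" using rad q EB dvd_trans by blast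
    hence "q dvd V * y\<^sup>2 - E" using q by simp
    hence "q dvd 2" using E(2) \<epsilon> by auto
    hence "q = 2" using q(1) by (metis primes_dvd_imp_eq two_is_prime)
    thus False using q odds by simp
  qed
  then obtain m where n: "n = 2 * m + 1" by (rule oddE)
  have "2 ^ n * B0 * D = 2 * (y * D) * odd_binom m (real_of_int E ^ 2) ((y * D)\<^sup>2)"
    using diff unfolding n by (simp only: odd_binom_diff)
  also have "(y * D)\<^sup>2 = real_of_int (d * y\<^sup>2)" using D2 by (simp add: power2_eq_square)
  finally have "real_of_int (4 ^ m * B0) = real_of_int (y * odd_binom m (E\<^sup>2) (d * y\<^sup>2))"
    using D2 by (simp add: n of_int_odd_binom power_mult)
  hence "4 ^ m * B0 = y * odd_binom m (E\<^sup>2) (d * y\<^sup>2)" by (simp only: of_int_eq_iff)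
  then obtain M where M: "B0 = y * M" "4 ^ m * M = odd_binom m (E\<^sup>2) (d * y\<^sup>2)"
    using coeff_dvd_of_odd_binom[OF odds(2)] by blast
  have E9: "E\<^sup>2 \<ge> 3\<^sup>2" using pos by (intro power_mono) auto
  \<comment> \<open>Here the difference \<open>u - w\<close> is -4, so the Fibonacci exception is
    ruled out by its sign.\<close>
  have "m = 0 \<or> m = 2 \<and> d * y\<^sup>2 = 5 \<and> E\<^sup>2 = 1 \<and> M = 5 \<and> (-1::int) = 1"
  proof (rule odd_binom_radical[OF _ _ _ _ _ M(2)])
    show "d * y\<^sup>2 - E\<^sup>2 = 4 * (-1)" "3 \<le> d * y\<^sup>2" "E\<^sup>2 > 0" using E9 E(1) by auto
    show "odd (E\<^sup>2)" using odds by simp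
    show "odd M" using M(1) odds by simp
    show "q dvd d * y\<^sup>2" if "prime q" "q dvd M" for q
      using rad[of q] that M(1) E(3) dvd_trans by (metis dvd_mult dvd_mult2)
  qed auto
  hence m0: "m = 0" by auto
  have "B0 = y" using M unfolding m0 by (simp add: odd_binom_def)
  moreover have "A0 = E" using p1 calculation unfolding n m0 by simp
  ultimately show ?thesis by simp
qed

text \<open>The unit is the square of \<open>(C + y * D) / 2\<close>, so
  \<open>A0 * C + B0 * D\<close> is twice an odd power of that element and
  \<open>odd_binom_radical\<close> applies directly. Now the difference \<open>u - w\<close> is
  \<open>4 * \<epsilon>\<close>, so the Fibonacci exception can occur.\<close>

lemma solution_from_half_unit_power:
  fixes y A0 B0 V W E \<epsilon> \<sigma> :: int and C D :: real
  assumes odds: "odd V" "odd W" "odd y" "odd B0" and pos: "V > 1" "W > 0" "y > 0" "A0 > 0" "B0 > 0"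
    and W: "W = V * y\<^sup>2 - 4 * \<epsilon>" and E: "E = V * y\<^sup>2 - 2 * \<epsilon>" and \<epsilon>: "\<epsilon> = 1 \<or> \<epsilon> = -1" and \<sigma>: "\<sigma> = 1 \<or> \<sigma> = -1"
    and rad: "\<And>q. prime q \<Longrightarrow> q dvd B0 \<Longrightarrow> q dvd V"
    and eq: "A0\<^sup>2 * W - B0\<^sup>2 * V = 4 * \<sigma>"
    and C: "C = sqrt (real_of_int W)" and D: "D = sqrt (real_of_int V)"
    and p1: "2 ^ n * (A0 * C + B0 * D) = (C + y * D) * (E + y * C * D) ^ n"
    and p2: "2 ^ n * (A0 * C - B0 * D) = (C - y * D) * (E - y * C * D) ^ n"
  shows "A0 = 1 \<or> A0 = 11 \<and> B0 = 5 \<and> V = 5 \<and> y = 1 \<and> \<epsilon> = 1"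
proof -
  have sq: "C * C = W" "D * D = V" "D \<noteq> 0" "C \<noteq> 0" using pos by (auto simp: C D)
  have unit: "2 * (E + y * C * D) = (C + y * D)\<^sup>2" "2 * (E - y * C * D) = (C - y * D)\<^sup>2"
  proof -
    have "(C + y * D)\<^sup>2 = (C * C + y\<^sup>2 * (D * D)) + 2 * (y * C * D)" "(C - y * D)\<^sup>2 = (C * C + y\<^sup>2 * (D * D)) - 2 * (y * C * D)"
      by (simp_all add: power2_eq_square algebra_simps)
    moreover have "C * C + y\<^sup>2 * (D * D) = 2 * E" unfolding sq W E by simp
    ultimately show "2 * (E + y * C * D) = (C + y * D)\<^sup>2" "2 * (E - y * C * D) = (C - y * D)\<^sup>2" by simp_all
  qed
  have double: "4 ^ n * P = R * (2 * u) ^ n" if "2 ^ n * P = R * u ^ n" for P R u :: real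
  proof -
    have "4 ^ n * P = 2 ^ n * (2 ^ n * P)" by (simp add: power_mult_distrib[symmetric] mult.assoc[symmetric])
    thus ?thesis unfolding that by (simp add: power_mult_distrib)
  qed
  have "4 ^ n * (A0 * C + B0 * D) = (C + y * D) * (2 * (E + y * C * D)) ^ n"
    "4 ^ n * (A0 * C - B0 * D) = (C - y * D) * (2 * (E - y * C * D)) ^ n"
    using double[OF p1] double[OF p2] by blast+
  hence q: "4 ^ n * (A0 * C + B0 * D) = (C + y * D) ^ (2 * n + 1)"
    "4 ^ n * (A0 * C - B0 * D) = (C - y * D) ^ (2 * n + 1)"
    unfolding unit by (simp_all add: power_mult)
  have "2 * 4 ^ n * B0 * D = 2 * (y * D) * odd_binom n (C\<^sup>2) ((y * D)\<^sup>2)"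
    unfolding odd_binom_diff[symmetric] q[symmetric] by (simp add: algebra_simps)
  also have "(y * D)\<^sup>2 = real_of_int (V * y\<^sup>2)" using sq by (simp add: power2_eq_square)
  also have "C\<^sup>2 = W" using sq by (simp add: power2_eq_square)
  finally have "real_of_int (4 ^ n * B0) = real_of_int (y * odd_binom n W (V * y\<^sup>2))"
    using sq by (simp add: of_int_odd_binom)
  hence "4 ^ n * B0 = y * odd_binom n W (V * y\<^sup>2)" by (simp only: of_int_eq_iff)
  then obtain M where M: "B0 = y * M" "4 ^ n * M = odd_binom n W (V * y\<^sup>2)"
    using coeff_dvd_of_odd_binom[OF odds(3)] by blast
  have "n = 0 \<or> n = 2 \<and> V * y\<^sup>2 = 5 \<and> W = 1 \<and> M = 5 \<and> \<epsilon> = 1"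
  proof (rule odd_binom_radical[OF _ _ _ _ _ M(2)])
    have "V \<ge> 3" using pos odds by presburger
    moreover have "V * 1 \<le> V * y\<^sup>2" using pos by (intro mult_left_mono) auto
    ultimately show "3 \<le> V * y\<^sup>2" by linarith
    show "odd M" using M(1) odds by simp
    show "q dvd V * y\<^sup>2" if "prime q" "q dvd M" for q
      using rad[of q] that M(1) by simp
  qed (use W pos odds \<epsilon> in auto)
  thus ?thesis
  proof
    assume n: "n = 0"
    have "B0 = y" using M unfolding n by (simp add: odd_binom_def)
    hence "A0 = 1" using p1 sq unfolding n by simp
    thus ?thesis by simp
  next
    assume *: "n = 2 \<and> V * y\<^sup>2 = 5 \<and> W = 1 \<and> M = 5 \<and> \<epsilon> = 1"
    have y: "y = 1"
    proof (rule ccontr)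
      assume "y \<noteq> 1"
      hence "y \<ge> 3" using pos odds by presburger
      hence "y\<^sup>2 \<ge> 3\<^sup>2" by (intro power_mono) auto
      moreover have "1 * y\<^sup>2 \<le> V * y\<^sup>2" using pos by (intro mult_right_mono) auto
      ultimately show False using * by simp
    qed
    hence V: "V = 5" "B0 = 5" using * M by auto
    have A: "A0\<^sup>2 = 125 + 4 * \<sigma>" using eq V * by simp
    \<comment> \<open>Of the candidates 121 and 129 only the first is a square.\<close>
    have "11\<^sup>2 \<le> A0\<^sup>2" "A0\<^sup>2 < 12\<^sup>2" using A \<sigma> by auto
    hence "11 \<le> A0" "A0 < 12" using pos by (auto intro: power2_le_imp_le power2_less_imp_less)
    thus ?thesis using V y * by auto
  qed
qed

section \<open>Solutions of the split equation\<close>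

text \<open>Descent ends with \<open>X0 * Y0\<close> equal to 0 or \<open>y\<close>. Since
  \<open>B1 > 1\<close> is odd and cannot divide 4, only two end points survive:
  \<open>c = 1\<close>, where powers of the unit arise, and \<open>X0 = 1\<close>,
  \<open>Y0 = y\<close>, where its square root enters.\<close>

lemma coprime_split_solutions:
  fixes A0 A1 B0 B1 g h y \<epsilon> \<sigma> :: int
  assumes pos: "A0 > 0" "A1 > 0" "B0 > 0" "B1 > 1" "g > 0" "h > 0" "y > 0"
    and odds: "odd A1" "odd B0" "odd B1" "odd g" "odd h" "odd y"
    and \<epsilon>: "\<epsilon> = 1 \<or> \<epsilon> = -1" and \<sigma>: "\<sigma> = 1 \<or> \<sigma> = -1"
    and eq: "A0\<^sup>2 * A1 * g - B0\<^sup>2 * B1 * h = 4 * \<sigma>" and gh: "g * h = A1 * B1 * y\<^sup>2 - 4 * \<epsilon>"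
    and rad: "\<And>q. prime q \<Longrightarrow> q dvd B0 \<Longrightarrow> q dvd B1"
  shows "A1 = 1 \<and> (B0 = y \<and> A0 = B1 * y\<^sup>2 - 2 * \<epsilon> \<or> A0 = 1 \<or>
    A0 = 11 \<and> B0 = 5 \<and> B1 = 5 \<and> y = 1 \<and> \<epsilon> = 1)"
proof -
  define c d E where "c = A1 * g" and "d = B1 * h" and "E = A1 * B1 * y\<^sup>2 - 2 * \<epsilon>"
  have cd: "c * d = (A1 * B1) * ((A1 * B1) * y\<^sup>2 - 4 * \<epsilon>)"
    unfolding c_def d_def using gh by (metis mult.assoc mult.left_commute)
  have E2: "E\<^sup>2 = c * d * y\<^sup>2 + 4"
    unfolding cd E_def using \<epsilon> by (auto simp: power2_eq_square algebra_simps)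
  have cdpos: "c > 0" "d > 1" using pos by (auto simp: c_def d_def less_1_mult')
  have cdodd: "odd c" "odd d" "odd E" using odds \<epsilon> by (auto simp: c_def d_def E_def)
  have "g * h > 0" using pos by simp
  hence "E > 2 * \<epsilon>" by (simp add: E_def gh)
  hence "E > -2" using \<epsilon> by auto
  moreover have "E\<^sup>2 > 2\<^sup>2" unfolding E2 using cdpos pos by simp
  hence "\<bar>E\<bar> > \<bar>2\<bar>" by (simp only: abs_le_square_iff not_le[symmetric] simp_thms)
  ultimately have E3: "E > 2" by linarith
  have min: "y \<le> e" if "e > 0" "Z\<^sup>2 = c * d * e\<^sup>2 + 4" for e Z
  proof (rule unit_coefficient_ge[where N = "A1 * B1"])
    have "1 * 1 < A1 * B1" using pos by (intro mult_le_less_imp_less) auto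
    hence "1 * 1 < A1 * B1 * e" using that by (intro mult_less_le_imp_less) auto
    thus "A1 * B1 * e > 1" by simp
  qed (use that pos odds \<epsilon> cd in auto)
  have eq': "c * A0\<^sup>2 - d * B0\<^sup>2 = 4 * \<sigma>" using eq by (simp add: c_def d_def algebra_simps)
  define C D where "C = sqrt (real_of_int c)" and "D = sqrt (real_of_int d)"
  have d0: "d > 0" and nonneg: "A0 \<ge> 0" "B0 \<ge> 0" using cdpos pos by auto
  obtain n X0 Y0 where XY: "c * X0\<^sup>2 - d * Y0\<^sup>2 = 4 * \<sigma>" "X0 \<ge> 0" "Y0 \<ge> 0" "X0 * Y0 = 0 \<or> X0 * Y0 = y"
    and p1: "2 ^ n * (A0 * C + B0 * D) = (X0 * C + Y0 * D) * (E + y * C * D) ^ n"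
    and p2: "2 ^ n * (A0 * C - B0 * D) = (X0 * C - Y0 * D) * (E - y * C * D) ^ n"
    by (rule orbit_representative[OF cdodd(1,2) odds(6) cdodd(3) cdpos(1) d0 pos(7) E3 E2 \<sigma> min eq' nonneg,
          folded C_def D_def])
  have no_dvd4: "\<not> B1 dvd 4" using odd_dvd_four_imp_unit[of B1] pos odds by auto
  have dvd4: "k dvd 4" if "k dvd 4 * \<sigma> \<or> k dvd 4 * \<epsilon>" for k using that \<epsilon> \<sigma> by auto
  have W4: "A1 * B1 * y\<^sup>2 - g * h = 4 * \<epsilon>" using gh by simp
  consider "X0 = 0" | "Y0 = 0" | "X0 * Y0 = y" using XY by auto
  thus ?thesis
  proof cases
    case 1
    hence "4 * \<sigma> = B1 * (- h * Y0\<^sup>2)" using XY(1) by (simp add: d_def)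
    hence "B1 dvd 4" using dvd4 by (metis dvd_triv_left)
    thus ?thesis using no_dvd4 by blast
  next
    case 2
    hence c4: "c * X0\<^sup>2 = 4 * \<sigma>" using XY(1) by simp
    hence "c dvd 4" using dvd4 by (metis dvd_triv_left)
    hence c1: "c = 1" using odd_dvd_four_imp_unit cdodd cdpos by blast
    hence A1: "A1 = 1" "g = 1" using pos by (auto simp: c_def zmult_eq_1_iff)
    have "\<sigma> \<noteq> -1"
    proof
      assume "\<sigma> = -1"
      hence "X0\<^sup>2 = -4" using c4 c1 by simp
      thus False using zero_le_power2[of X0] by linarith
    qed
    hence "\<sigma> = 1" using \<sigma> by simp
    hence "X0\<^sup>2 = 2\<^sup>2" using c4 c1 by simp
    hence X0: "X0 = 2" using XY by (metis power2_eq_iff_nonneg zero_le_numeral)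
    have "A0 = E \<and> B0 = y"
    proof (rule solution_from_unit_power[where V = B1 and d = d and D = D])
      show "2 ^ n * (A0 + B0 * D) = 2 * (E + y * D) ^ n" "2 ^ n * (A0 - B0 * D) = 2 * (E - y * D) ^ n"
        using p1 p2 unfolding X0 2 C_def c1 by simp_all
      show "E\<^sup>2 = d * y\<^sup>2 + 4" using E2 c1 by simp
      show "E = B1 * y\<^sup>2 - 2 * \<epsilon>" using A1 by (simp add: E_def)
    qed (use cdodd cdpos odds pos E3 \<epsilon> rad D_def d_def in auto)
    thus ?thesis using A1 by (simp add: E_def)
  next
    case 3
    \<comment> \<open>With \<open>X0 * Y0 = y\<close> the square of the representative is the unit
      itself, so sum and difference determine
      \<open>c * X0\<^sup>2 = E + 2 * \<sigma>\<close>.\<close>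
    have "(c * X0\<^sup>2 + d * Y0\<^sup>2)\<^sup>2 = (c * X0\<^sup>2 - d * Y0\<^sup>2)\<^sup>2 + 4 * (c * d * (X0 * Y0)\<^sup>2)"
      by (simp add: power2_eq_square algebra_simps)
    also have "\<dots> = (2 * E)\<^sup>2" unfolding XY(1) 3 power_mult_distrib E2 using \<sigma> by auto
    finally have sum: "c * X0\<^sup>2 + d * Y0\<^sup>2 = 2 * E"
      using cdpos E3 by (metis (no_types, lifting) power2_eq_iff_nonneg add_nonneg_nonneg mult_nonneg_nonneg
          zero_le_power2 less_imp_le order.strict_trans zero_less_numeral zero_less_one zero_le_numeral)
    have cX: "c * X0\<^sup>2 = E + 2 * \<sigma>" using sum XY(1) by simp
    have X0: "X0 > 0" "Y0 > 0" using XY 3 pos by (auto simp: le_less)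
    show ?thesis
    proof (cases "\<sigma> = \<epsilon>")
      case True
      have "A1 * (g * X0\<^sup>2) = A1 * (B1 * Y0\<^sup>2 * X0\<^sup>2)"
        using cX True unfolding c_def E_def 3[symmetric] by (simp add: power_mult_distrib algebra_simps)
      hence "g = B1 * Y0\<^sup>2" using pos X0 by simp
      hence "B1 dvd g * h" by simp
      hence "B1 dvd A1 * B1 * y\<^sup>2 - g * h" by simp
      hence "B1 dvd 4" unfolding W4 by (intro dvd4 disjI2)
      thus ?thesis using no_dvd4 by blast
    next
      case False
      hence s: "\<sigma> = - \<epsilon>" using \<epsilon> \<sigma> by auto
      have "g * (A1 * X0\<^sup>2) = g * h"
        using cX s unfolding c_def E_def gh by (simp add: algebra_simps)
      hence h: "h = A1 * X0\<^sup>2" using pos by simp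
      hence "A1 dvd g * h" by simp
      hence "A1 dvd A1 * B1 * y\<^sup>2 - g * h" by simp
      hence "A1 dvd 4" unfolding W4 by (intro dvd4 disjI2)
      hence A1: "A1 = 1" using odd_dvd_four_imp_unit odds pos by blast
      have "X0 dvd A1 * B1 * y\<^sup>2 - g * h" using h 3 by (auto simp: power2_eq_square)
      hence "X0 dvd 4" unfolding W4 by (intro dvd4 disjI2)
      moreover have "odd X0" using h odds by simp
      ultimately have X1: "X0 = 1" using odd_dvd_four_imp_unit X0 by blast
      hence h1: "h = 1" and Y0: "Y0 = y" using h A1 3 by auto
      have c: "c = g" and d: "d = B1" using A1 h1 by (auto simp: c_def d_def)
      have "A0 = 1 \<or> A0 = 11 \<and> B0 = 5 \<and> B1 = 5 \<and> y = 1 \<and> \<epsilon> = 1"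
      proof (rule solution_from_half_unit_power[where W = g and E = E and C = C and D = D and n = n and \<sigma> = \<sigma>])
        show "2 ^ n * (A0 * C + B0 * D) = (C + y * D) * (E + y * C * D) ^ n"
          "2 ^ n * (A0 * C - B0 * D) = (C - y * D) * (E - y * C * D) ^ n"
          using p1 p2 unfolding X1 Y0 by simp_all
        show "g = B1 * y\<^sup>2 - 4 * \<epsilon>" using gh h1 A1 by simp
        show "A0\<^sup>2 * g - B0\<^sup>2 * B1 = 4 * \<sigma>" using eq A1 h1 by simp
      qed (use A1 odds pos \<epsilon> \<sigma> rad C_def D_def c d E_def in auto)
      thus ?thesis using A1 by blast
    qed
  qed
qed

section \<open>Splitting products into coprime factors\<close>

lemma coprime_intI_primes:
  fixes a b :: int
  assumes "a \<noteq> 0" and "\<And>q. prime q \<Longrightarrow> q dvd a \<Longrightarrow> q dvd b \<Longrightarrow> False"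
  shows "coprime a b"
proof (rule ccontr)
  assume "\<not> coprime a b"
  hence "\<not> is_unit (gcd a b)" by (simp only: is_unit_gcd simp_thms)
  then obtain q where "prime q" "q dvd gcd a b"
    using prime_divisor_exists[of "gcd a b"] assms(1) by auto
  thus False using assms(2) by auto
qed

lemma pos_division_decomp:
  fixes a b c :: int
  assumes "a dvd b * c" "a > 0"
  obtains b' c' where "a = b' * c'" "b' dvd b" "c' dvd c" "b' > 0" "c' > 0"
proof -
  obtain b' c' where "a = b' * c'" "b' dvd b" "c' dvd c"
    using division_decomp[OF assms(1)] by blast
  moreover from this have "a = \<bar>b'\<bar> * \<bar>c'\<bar>" "b' \<noteq> 0" "c' \<noteq> 0" using assms(2) by (auto simp: abs_mult[symmetric])
  ultimately show ?thesis using that[of "\<bar>b'\<bar>" "\<bar>c'\<bar>"] by simp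
qed

lemma product_factorization:
  fixes m n F W :: int
  assumes "m * n = F * W" "F > 0" "m > 0" "n > 0"
  obtains A B g h where "m = A * g" "n = B * h" "A * B = F" "g * h = W" "A > 0" "B > 0" "g > 0" "h > 0"
proof -
  have "F dvd m * n" using assms by simp
  then obtain A B where AB: "F = A * B" "A dvd m" "B dvd n" "A > 0" "B > 0"
    using pos_division_decomp assms(2) by metis
  then obtain g h where gh: "m = A * g" "n = B * h" by (auto elim!: dvdE)
  have "F * (g * h) = F * W" using assms(1) unfolding gh AB(1) by (simp only: mult_ac)
  hence "g * h = W" using assms(2) by simp
  moreover have "g > 0" "h > 0" using assms AB gh by (auto simp: zero_less_mult_iff)
  ultimately show ?thesis using that gh AB by blast
qed

text \<open>Split \<open>U = P * Q\<close> with \<open>P dvd A\<close> and \<open>Q dvd B\<close>.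
  As \<open>P\<close> is coprime to \<open>B\<close>, the divisor \<open>P\<^sup>2\<close> of
  \<open>A * B\<close> must divide \<open>A\<close>; likewise \<open>Q\<^sup>2\<close> divides
  \<open>B\<close>.\<close>

lemma square_part:
  fixes U V A B :: int
  assumes "coprime A B" "A * B = U\<^sup>2 * V" "U > 0" "A > 0" "B > 0"
  obtains A0 A1 B0 B1 where "A = A0\<^sup>2 * A1" "B = B0\<^sup>2 * B1" "A0 * B0 = U" "A1 * B1 = V"
    "A0 > 0" "A1 > 0" "B0 > 0" "B1 > 0"
proof -
  have "A * B = U * (U * V)" using assms(2) by (simp add: power2_eq_square mult.assoc)
  then have "U dvd A * B" by simp
  then obtain P Q where PQ: "U = P * Q" "P dvd A" "Q dvd B" and pos: "P > 0" "Q > 0"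
    using pos_division_decomp assms(3) by metis
  have "P\<^sup>2 dvd A * B" "Q\<^sup>2 dvd A * B" unfolding assms(2) PQ(1) by (simp_all add: power_mult_distrib mult.assoc)
  moreover have "coprime (P\<^sup>2) B" "coprime (Q\<^sup>2) A" using PQ assms(1)
    by (meson coprime_divisors coprime_power_left_iff coprime_commute dvd_refl)+
  ultimately have "P\<^sup>2 dvd A" "Q\<^sup>2 dvd B"
    by (simp_all add: coprime_dvd_mult_left_iff coprime_dvd_mult_right_iff)
  then obtain A1 B1 where 1: "A = P\<^sup>2 * A1" "B = Q\<^sup>2 * B1" by (auto elim!: dvdE)
  have "U\<^sup>2 * (A1 * B1) = U\<^sup>2 * V"
    unfolding assms(2)[symmetric] unfolding 1 PQ(1) by (simp add: power_mult_distrib mult_ac)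
  hence "A1 * B1 = V" using assms(3) by (metis mult_cancel_left power_not_zero less_irrefl)
  moreover have "A1 > 0" "B1 > 0" using assms pos unfolding 1 by (auto simp: zero_less_mult_iff)
  ultimately show ?thesis using that[OF 1 PQ(1)[symmetric]] pos by blast
qed

section \<open>Case distinction by the distribution of \<open>U\<^sup>2 * V\<close>\<close>

text \<open>Eliminating \<open>h\<close> gives \<open>V * (U * g - y) * (U * g + y) = 4 * (\<tau> *
  g - \<epsilon>)\<close>. By parity a nonzero difference \<open>U * g - y\<close> is at least 2 in
  absolute value, which makes the left side too large.\<close>

lemma solution_one_sided:
  fixes U V y g h \<epsilon> \<tau> :: int
  assumes "V \<ge> 3" "U \<ge> 3" "g > 0" "y > 0" "odd U" "odd g" "odd y"
    and \<epsilon>: "\<epsilon> = 1 \<or> \<epsilon> = -1" and \<tau>: "\<tau> = 1 \<or> \<tau> = -1"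
    and "U\<^sup>2 * V * g - h = 4 * \<tau>" "g * h = V * y\<^sup>2 - 4 * \<epsilon>"
  shows "y = U"
proof -
  have h: "h = U\<^sup>2 * V * g - 4 * \<tau>" using assms by simp
  have eq: "V * ((U * g - y) * (U * g + y)) = 4 * (\<tau> * g - \<epsilon>)"
    using assms(11) unfolding h by (simp add: power2_eq_square algebra_simps)
  have "U * g = y"
  proof (rule ccontr)
    assume "U * g \<noteq> y"
    moreover have "even (U * g - y)" using assms by simp
    ultimately have "2 \<le> \<bar>U * g - y\<bar>" by presburger
    hence "3 * (2 * (U * g + y)) \<le> V * (\<bar>U * g - y\<bar> * (U * g + y))"
      using assms by (intro mult_mono) auto
    also have "\<dots> = \<bar>4 * (\<tau> * g - \<epsilon>)\<bar>" unfolding eq[symmetric] using assms by (simp add: abs_mult)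
    also have "\<dots> \<le> 4 * (g + 1)" using \<epsilon> \<tau> assms(3) by auto
    finally have "6 * (U * g) + 6 * y \<le> 4 * g + 4" by simp
    moreover have "3 * g \<le> U * g" using assms by (intro mult_right_mono) auto
    ultimately show False using assms by linarith
  qed
  moreover from this have "\<tau> * g = \<epsilon>" using eq by simp
  hence "g = 1" using \<epsilon> \<tau> assms(3) by auto
  ultimately show ?thesis by simp
qed

lemma solution_cases:
  fixes p U V x y \<epsilon> :: int
  assumes p: "prime p" "p dvd U" and "odd U" "odd V" "odd y" and pos: "U > 0" "V \<ge> 3" "y > 0" "x > 0"
    and \<epsilon>: "\<epsilon> = 1 \<or> \<epsilon> = -1" and eq: "x\<^sup>2 = U\<^sup>2 * V\<^sup>2 * y\<^sup>2 - 4 * \<epsilon> * U\<^sup>2 * V + 4"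
    and rad: "\<And>q. prime q \<Longrightarrow> q dvd U \<Longrightarrow> q = p \<or> q dvd V"
  shows "y = U \<or> (\<exists>P. U = P * y \<and> P > 0 \<and> coprime P y \<and> coprime P V \<and> p dvd P \<and> P = V * y\<^sup>2 - 2 * \<epsilon>)
    \<or> U = 55 \<and> p = 11 \<and> V = 5 \<and> y = 1 \<and> \<epsilon> = 1"
proof -
  define W where "W = V * y\<^sup>2 - 4 * \<epsilon>"
  have x4: "(x + 2) * (x - 2) = U\<^sup>2 * V * W"
    unfolding W_def using eq by (simp add: power2_eq_square algebra_simps)
  have oddx: "odd x"
  proof -
    have "odd (x\<^sup>2)" unfolding eq using assms by simp
    thus ?thesis by simp
  qed
  have oddW: "odd W" using assms by (simp add: W_def)
  have "p \<noteq> 2" using p assms by auto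
  hence p3: "p \<ge> 3" using p(1) prime_ge_2_int[of p] by simp
  have "p \<le> U" using p(2) pos(1) by (rule zdvd_imp_le)
  hence U3: "U \<ge> 3" using p3 by simp
  have F3: "U\<^sup>2 * V \<ge> 27"
  proof -
    have "3\<^sup>2 * 3 \<le> U\<^sup>2 * V" using U3 pos by (intro mult_mono power_mono) auto
    thus ?thesis by simp
  qed
  have W0: "W > 0"
  proof (rule ccontr)
    assume "\<not> W > 0"
    hence "W \<le> -1" using oddW by presburger
    hence "U\<^sup>2 * V * W \<le> U\<^sup>2 * V * (-1)" using F3 by (intro mult_left_mono) auto
    hence "(x + 2) * (x - 2) \<le> -27" unfolding x4 using F3 by linarith
    moreover have "(x + 2) * (x - 2) = x\<^sup>2 - 4" by (simp add: power2_eq_square algebra_simps)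
    ultimately show False using zero_le_power2[of x] by linarith
  qed
  hence "(x + 2) * (x - 2) > 0" unfolding x4 using F3 by simp
  hence x2: "x > 2" using pos by (simp add: zero_less_mult_iff)
  have "p dvd (x + 2) * (x - 2)" unfolding x4 using p by (simp add: power2_eq_square)
  hence "p dvd x + 2 \<or> p dvd x - 2" using p prime_dvd_mult_iff by blast
  \<comment> \<open>The sign is chosen so that \<open>p\<close> lies in \<open>m\<close>. Then
    \<open>p\<close> does not divide \<open>B0\<close>, and every prime factor of \<open>B0\<close>
    divides \<open>V\<close>, hence \<open>B1\<close> by coprimality.\<close>
  then obtain \<tau> :: int where \<tau>: "\<tau> = 1 \<or> \<tau> = -1" and pm: "p dvd x + 2 * \<tau>" by fastforce
  define m n where "m = x + 2 * \<tau>" and "n = x - 2 * \<tau>"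
  have mn: "m * n = (U\<^sup>2 * V) * W" unfolding m_def n_def x4[symmetric] using \<tau> by (auto simp: algebra_simps)
  have mnpos: "m > 0" "n > 0" using x2 \<tau> by (auto simp: m_def n_def)
  have cop: "coprime m n"
  proof (rule coprime_intI_primes)
    show "m \<noteq> 0" using mnpos by simp
    fix q :: int assume q: "prime q" "q dvd m" "q dvd n"
    hence "q dvd m - n" by simp
    moreover have "m - n = 4 * \<tau>" by (simp add: m_def n_def)
    ultimately have "q dvd 2 ^ 2" using \<tau> by auto
    hence "q dvd 2" using q prime_dvd_power by blast
    hence "q = 2" using q by (metis primes_dvd_imp_eq two_is_prime)
    thus False using q oddx by (simp add: m_def)
  qed
  have F0: "U\<^sup>2 * V > 0" using F3 by simp
  obtain A B g h where mn': "m = A * g" "n = B * h" and AB: "A * B = U\<^sup>2 * V" and gh: "g * h = W"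
    and pos2: "A > 0" "B > 0" "g > 0" "h > 0"
    using product_factorization[OF mn F0 mnpos] .
  have copAB: "coprime A B" using cop unfolding mn' by simp
  obtain A0 A1 B0 B1 where A: "A = A0\<^sup>2 * A1" and B: "B = B0\<^sup>2 * B1" and U: "A0 * B0 = U" and V: "A1 * B1 = V"
    and pos3: "A0 > 0" "A1 > 0" "B0 > 0" "B1 > 0"
    using square_part[OF copAB AB pos(1) pos2(1,2)] .
  have odds: "odd A0" "odd A1" "odd B0" "odd B1" "odd g" "odd h"
    using U V gh oddW assms by auto
  have pA: "p dvd A"
  proof -
    have "p dvd A * B" unfolding AB using p by (simp add: power2_eq_square)
    moreover have "\<not> p dvd B"
      using cop pm p(1) unfolding mn' m_def[symmetric]
      by (metis coprime_common_divisor dvd_mult2 mn'(1) not_prime_unit)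
    ultimately show ?thesis using p prime_dvd_mult_iff by blast
  qed
  have excl: False if "prime q" "q dvd A" "q dvd B" for q
    using that copAB by (meson coprime_common_divisor not_prime_unit)
  have radB: "q dvd B1" if q: "prime q" "q dvd B0" for q
  proof -
    have qB: "q dvd B" using q by (simp add: B power2_eq_square mult.assoc)
    have "q dvd V" using rad[OF q(1)] excl[OF q(1) _ qB] q U pA by auto
    hence "q dvd A1 \<or> q dvd B1" using V q prime_dvd_mult_iff by blast
    thus ?thesis using excl[OF q(1) _ qB] by (auto simp: A)
  qed
  have diff: "A0\<^sup>2 * A1 * g - B0\<^sup>2 * B1 * h = 4 * \<tau>"
    unfolding A[symmetric] B[symmetric] mn'[symmetric] by (simp add: m_def n_def)
  show ?thesis
  proof (cases "B1 = 1")
    case True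
    have "B0 = 1"
    proof (rule ccontr)
      assume "B0 \<noteq> 1"
      then obtain q where q: "prime q" "q dvd B0" using prime_divisor_exists[of B0] pos3 by auto
      hence "q dvd 1" using radB True by blast
      thus False using q not_prime_unit by blast
    qed
    hence "A0 = U" "A1 = V" using U V True by auto
    thus ?thesis
      using solution_one_sided[of V U g y \<epsilon> \<tau> h] diff gh True \<open>B0 = 1\<close> U3 pos pos2 odds assms(3,5) \<epsilon> \<tau>
      by (simp add: W_def)
  next
    case False
    hence B1: "B1 > 1" using pos3 by simp
    have W: "g * h = A1 * B1 * y\<^sup>2 - 4 * \<epsilon>" using gh V by (simp add: W_def)
    have A1: "A1 = 1" and cases: "B0 = y \<and> A0 = B1 * y\<^sup>2 - 2 * \<epsilon> \<or> A0 = 1 \<or>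
        A0 = 11 \<and> B0 = 5 \<and> B1 = 5 \<and> y = 1 \<and> \<epsilon> = 1"
      using coprime_split_solutions[OF pos3(1,2,3) B1 pos2(3,4) pos(3) odds(2,3,4,5,6) assms(5) \<epsilon> \<tau> diff W radB]
      by blast+
    have pA0: "p dvd A0" using pA p(1) unfolding A A1 by (simp add: prime_dvd_power_iff)
    have V1: "B1 = V" using V A1 by simp
    have copP: "coprime A0 B0" "coprime A0 B1"
      using copAB unfolding A B A1 by simp_all
    from cases consider "B0 = y" "A0 = B1 * y\<^sup>2 - 2 * \<epsilon>" | "A0 = 1" | "A0 = 11" "B0 = 5" "B1 = 5" "y = 1" "\<epsilon> = 1"
      by blast
    thus ?thesis
    proof cases
      case 1
      thus ?thesis using U copP pA0 V1 pos3 by blast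
    next
      case 2
      \<comment> \<open>\<open>A0 = 1\<close> is impossible because \<open>p\<close> divides
        \<open>A0\<close>.\<close>
      thus ?thesis using pA0 p by (simp add: not_prime_unit)
    next
      case 3
      moreover have "p = 11"
      proof -
        have "prime (11 :: int)" by simp
        thus ?thesis using pA0 3 p primes_dvd_imp_eq by blast
      qed
      ultimately show ?thesis using U V1 by auto
    qed
  qed
qed

section \<open>Translation to \<open>U\<close> and \<open>V\<close> and identification of the
  parameters\<close>

theorem theorem4p14:
  fixes p :: int and s :: nat and k :: "nat \<Rightarrow> int"
    and x y \<delta> :: int and a b :: nat and t r :: "nat \<Rightarrow> nat"
  assumes "prime p" and "odd p" and "s \<ge> 1"
    and "\<And>i. i \<in> {1..s} \<Longrightarrow> k i > 1 \<and> odd (k i)"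
    and "\<delta> \<in> {-4, 4}"
    and "x > 0" and "y > 0" and "a > 0" and "b > 0"
    and "\<And>i. i \<in> {1..s} \<Longrightarrow> t i > 0"
    and "odd y"
    and "\<And>i. i \<in> {1..s} \<Longrightarrow> t i > r i"
    and "a \<ge> b"
  shows "x ^ 2 = p ^ (2 * a) * (\<Prod>i=1..s. k i ^ (2 * t i)) * y ^ 2
                 - p ^ (a + b) * (\<Prod>i=1..s. k i ^ (t i + r i)) * \<delta> + 4
     \<longleftrightarrow>
       (x = 123 \<and> y = 1 \<and> p = 11 \<and> s = 1 \<and> r 1 = 1 \<and> t 1 = 2 \<and> k 1 = 5
          \<and> a = 1 \<and> b = 1 \<and> \<delta> = 4)
     \<or> (p dvd y
          \<and> x = p ^ (a + b) * (\<Prod>i=1..s. k i ^ (t i + r i)) - \<delta> div 2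
          \<and> y = p ^ b * (\<Prod>i=1..s. k i ^ r i))
     \<or> (\<not> p dvd y
          \<and> p ^ b = (\<Prod>i=1..s. k i ^ (t i + r i)) - \<delta> div 2
          \<and> x = p ^ (2 * b) - 2
          \<and> y = (\<Prod>i=1..s. k i ^ r i)
          \<and> a = b)"
    (is "?eq \<longleftrightarrow> ?exc \<or> ?A \<or> ?B")
proof -
  define \<epsilon> where "\<epsilon> = \<delta> div 4"
  define R where "R = (\<Prod>i=1..s. k i ^ r i)"
  define V1 where "V1 = (\<Prod>i=1..s. k i ^ (t i - r i))"
  define U V where "U = p ^ b * R" and "V = p ^ (a - b) * V1"
  have \<delta>: "\<delta> = 4 * \<epsilon>" "\<delta> div 2 = 2 * \<epsilon>" and \<epsilon>: "\<epsilon> = 1 \<or> \<epsilon> = -1"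
    using assms(5) by (auto simp: \<epsilon>_def)
  have K2: "(\<Prod>i=1..s. k i ^ (2 * t i)) = (R * V1)\<^sup>2"
    unfolding R_def V1_def prod.distrib[symmetric] prod_power_distrib
    using assms(12) by (intro prod.cong) (auto simp: power_add[symmetric] power_mult[symmetric] mult.commute less_imp_le)
  have KR: "(\<Prod>i=1..s. k i ^ (t i + r i)) = R\<^sup>2 * V1"
    unfolding R_def V1_def prod.distrib[symmetric] prod_power_distrib
    using assms(12) by (intro prod.cong) (auto simp: power_add[symmetric] power_mult[symmetric] less_imp_le add.commute)
  have pa: "p ^ a = p ^ b * p ^ (a - b)" using assms(13) by (simp add: power_add[symmetric])
  have pab: "p ^ (a + b) * (\<Prod>i=1..s. k i ^ (t i + r i)) = U\<^sup>2 * V"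
    unfolding KR unfolding U_def V_def power_add pa by (simp add: power2_eq_square mult_ac)
  have p2a: "p ^ (2 * a) * (\<Prod>i=1..s. k i ^ (2 * t i)) = U\<^sup>2 * V\<^sup>2"
    unfolding K2 unfolding U_def V_def mult.commute[of 2 a] power_mult pa by (simp add: power_mult_distrib mult_ac)
  have eq: "?eq \<longleftrightarrow> x\<^sup>2 = U\<^sup>2 * V\<^sup>2 * y\<^sup>2 - 4 * \<epsilon> * U\<^sup>2 * V + 4"
    unfolding pab p2a \<delta> by (simp add: mult_ac)
  have p1: "p > 1" using assms(1) by (simp add: prime_gt_1_int)
  have k: "0 < k i" "odd (k i)" if "i \<in> {1..s}" for i
    using assms(4)[OF that] by auto
  have R0: "R > 0" "odd R"
    unfolding R_def using k by (auto intro!: prod_pos zero_less_power simp: even_prod_iff) 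
  have fac: "k i dvd V1" "3 \<le> k i" if "i \<in> {1..s}" for i
  proof -
    have "k i ^ (t i - r i) dvd V1" unfolding V1_def using that by (intro dvd_prodI) auto
    moreover have "k i dvd k i ^ (t i - r i)" using assms(12)[OF that] by (intro dvd_power) auto
    ultimately show "k i dvd V1" by (rule dvd_trans[rotated])
    show "3 \<le> k i" using assms(4)[OF that] by presburger
  qed
  have V10: "V1 > 0" "odd V1"
    unfolding V1_def using k by (auto intro!: prod_pos zero_less_power simp: even_prod_iff)
  have V13: "V1 \<ge> 3" using fac[of 1] assms(3) V10 zdvd_imp_le by fastforce
  have U: "U > 0" "odd U" "p dvd U" using R0 p1 assms(2,9) by (auto simp: U_def)
  have "1 * V1 \<le> V" unfolding V_def using V10 p1 by (intro mult_right_mono) auto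
  hence V: "V \<ge> 3" using V13 by linarith
  have oddV: "odd V" using V10 assms(2) by (simp add: V_def)
  \<comment> \<open>Because \<open>t i > r i\<close>, every \<open>k i\<close> divides
    \<open>V1\<close>; this is the source of the radical condition.\<close>
  have radR: "q dvd V1" if q: "prime q" "q dvd R" for q
  proof -
    obtain i where i: "i \<in> {1..s}" "q dvd k i ^ r i"
      using q prime_dvd_prod_iff[of "{1..s}" q] unfolding R_def by auto
    have "q dvd k i" using i q prime_dvd_power by blast
    thus ?thesis using fac[OF i(1)] dvd_trans by blast
  qed
  have rad: "q = p \<or> q dvd V" if q: "prime q" "q dvd U" for q
  proof -
    have "q dvd p ^ b \<or> q dvd R" using q prime_dvd_mult_iff unfolding U_def by blast
    thus ?thesis
    proof
      assume "q dvd p ^ b"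
      hence "q dvd p" using q prime_dvd_power by blast
      thus ?thesis using q assms(1) primes_dvd_imp_eq by blast
    next
      assume "q dvd R"
      thus ?thesis using radR q by (simp add: V_def)
    qed
  qed
  show ?thesis
  proof
    assume ?eq
    hence E: "x\<^sup>2 = U\<^sup>2 * V\<^sup>2 * y\<^sup>2 - 4 * \<epsilon> * U\<^sup>2 * V + 4" using eq by blast
    consider "y = U" | P where "U = P * y" "P > 0" "coprime P y" "coprime P V" "p dvd P" "P = V * y\<^sup>2 - 2 * \<epsilon>"
      | "U = 55" "p = 11" "V = 5" "y = 1" "\<epsilon> = 1"
      using solution_cases[OF assms(1) U(3,2) oddV assms(11) U(1) V assms(7,6) \<epsilon> E rad] by blast
    thus "?exc \<or> ?A \<or> ?B"
    proof cases
      case 1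
      have "x\<^sup>2 = (U\<^sup>2 * V - 2 * \<epsilon>)\<^sup>2"
        unfolding E 1 using \<epsilon> by (auto simp: power2_eq_square algebra_simps)
      moreover have "1 * 3 \<le> U\<^sup>2 * V" using U V by (intro mult_mono) auto
      hence "U\<^sup>2 * V - 2 * \<epsilon> \<ge> 0" using \<epsilon> by auto
      ultimately have "x = U\<^sup>2 * V - 2 * \<epsilon>" using assms(6) by (simp add: power2_eq_iff_nonneg)
      hence ?A using U(3) pab \<delta> 1 by (simp add: U_def R_def)
      thus ?thesis by blast
    next
      case 2
      have npV: "\<not> p dvd V" using 2 assms(1) by (meson coprime_common_divisor not_prime_unit)
      have ab: "a = b"
      proof (rule ccontr)
        assume "a \<noteq> b"
        hence "a - b > 0" using assms(13) by simp
        hence "p dvd p ^ (a - b)" by simp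
        thus False using npV by (simp add: V_def)
      qed
      hence VV1: "V = V1" by (simp add: V_def)
      have npR: "\<not> p dvd R" using radR assms(1) npV VV1 by blast
      have copR: "coprime P R"
      proof (rule coprime_intI_primes)
        show "P \<noteq> 0" using 2(2) by simp
        fix q :: int assume q: "prime q" "q dvd P" "q dvd R"
        hence "q dvd V" using radR VV1 by blast
        thus False using q 2(4) by (meson coprime_common_divisor not_prime_unit)
      qed
      have npy: "\<not> p dvd y" using 2 assms(1) by (meson coprime_common_divisor not_prime_unit)
      \<comment> \<open>\<open>P\<close> is coprime to \<open>R\<close>, since primes of
        \<open>R\<close> divide \<open>V\<close>, and \<open>p\<close> does not divide
        \<open>y\<close>. Comparing \<open>P * y = p ^ b * R\<close> therefore yields
        \<open>P = p ^ b\<close> and \<open>y = R\<close>.\<close>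
      have "P dvd p ^ b"
      proof -
        have "P dvd p ^ b * R" using 2(1) unfolding U_def by simp
        thus ?thesis using copR by (simp add: coprime_dvd_mult_left_iff)
      qed
      moreover have "p ^ b dvd P"
      proof -
        have "p ^ b dvd P * y" using 2(1) unfolding U_def by (metis dvd_triv_left)
        moreover have "coprime (p ^ b) y" using npy assms(1) by (simp add: prime_imp_coprime)
        ultimately show ?thesis by (simp add: coprime_dvd_mult_left_iff)
      qed
      ultimately have P: "P = p ^ b" using 2(2) p1 by (simp add: zdvd_antisym_nonneg)
      hence yR: "y = R" using 2(1) p1 unfolding U_def by simp
      have Pe: "p ^ b = R\<^sup>2 * V1 - 2 * \<epsilon>" using 2(6) P yR VV1 by simp
      have UP: "U\<^sup>2 * V = (p ^ b)\<^sup>2 * (p ^ b + 2 * \<epsilon>)"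
        unfolding U_def VV1 power_mult_distrib using Pe by simp
      have "U\<^sup>2 * V\<^sup>2 * y\<^sup>2 = (U\<^sup>2 * V) * (V * y\<^sup>2)" by (simp add: power2_eq_square mult_ac)
      also have "V * y\<^sup>2 = p ^ b + 2 * \<epsilon>" using 2(6) P by simp
      finally have "x\<^sup>2 = (p ^ b)\<^sup>2 * (p ^ b + 2 * \<epsilon>) * (p ^ b + 2 * \<epsilon>) - 4 * \<epsilon> * ((p ^ b)\<^sup>2 * (p ^ b + 2 * \<epsilon>)) + 4"
        unfolding E UP[symmetric] by (simp add: mult_ac)
      also have "\<dots> = ((p ^ b)\<^sup>2 - 2)\<^sup>2" using \<epsilon> by (auto simp: power2_eq_square algebra_simps)
      finally have "x\<^sup>2 = ((p ^ b)\<^sup>2 - 2)\<^sup>2" .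
      moreover have "p ^ 1 \<le> p ^ b" using p1 assms(9) by (intro power_increasing) auto
      hence "2\<^sup>2 \<le> (p ^ b)\<^sup>2" using p1 by (intro power_mono) auto
      ultimately have "x = (p ^ b)\<^sup>2 - 2" using assms(6) by (simp add: power2_eq_iff_nonneg)
      hence "x = p ^ (2 * b) - 2" by (simp add: power_mult mult.commute flip: power_mult)
      hence ?B using npy Pe yR ab KR \<delta> by (simp add: R_def)
      thus ?thesis by blast
    next
      case 3
      have ab: "a = b"
      proof (rule ccontr)
        assume "a \<noteq> b"
        hence "a - b > 0" using assms(13) by simp
        hence "p dvd p ^ (a - b)" by simp
        hence "p dvd V" by (simp add: V_def)
        thus False using 3 by simp
      qed
      hence V1: "V1 = 5" using 3 by (simp add: V_def)
      have b: "b = 1"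
      proof (rule ccontr)
        assume "b \<noteq> 1"
        hence "2 \<le> b" using assms(9) by simp
        hence "p ^ 2 dvd p ^ b" by (rule le_imp_power_dvd)
        hence "p ^ 2 dvd U" by (simp add: U_def)
        thus False using 3 by simp
      qed
      hence R: "R = 5" using 3 by (simp add: U_def)
      \<comment> \<open>Two factors \<open>k i \<ge> 3\<close> would give a divisor of
        \<open>V1 = 5\<close> that is at least 9.\<close>
      have s: "s = 1"
      proof (rule ccontr)
        assume "s \<noteq> 1"
        hence "{1, 2} \<subseteq> {1..s}" using assms(3) by auto
        hence "(\<Prod>i\<in>{1, 2}. k i ^ (t i - r i)) dvd V1"
          unfolding V1_def by (intro prod_dvd_prod_subset) auto
        moreover have "k 1 * k 2 dvd (\<Prod>i\<in>{1, 2}. k i ^ (t i - r i))"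
          using assms(12)[of 1] assms(12)[of 2] \<open>{1, 2} \<subseteq> {1..s}\<close> by (auto intro!: mult_dvd_mono dvd_power)
        ultimately have "k 1 * k 2 dvd 5" using V1 dvd_trans by metis
        hence "k 1 * k 2 \<le> 5" by (rule zdvd_imp_le) simp
        moreover have "3 * 3 \<le> k 1 * k 2"
          using fac(2)[of 1] fac(2)[of 2] \<open>{1, 2} \<subseteq> {1..s}\<close> by (intro mult_mono) auto
        ultimately show False by simp
      qed
      have "k 1 dvd 5" "3 \<le> k 1" using fac[of 1] s V1 by auto
      moreover from this have "k 1 \<le> 5" using zdvd_imp_le by fastforce
      hence "k 1 = 3 \<or> k 1 = 4 \<or> k 1 = 5" using \<open>3 \<le> k 1\<close> by auto
      ultimately have k: "k 1 = 5" by auto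
      have "k 1 ^ r 1 = 5 ^ 1" "k 1 ^ (t 1 - r 1) = 5 ^ 1" using R V1 s by (simp_all add: R_def V1_def)
      hence "r 1 = 1" "t 1 - r 1 = 1" unfolding k
        using power_inject_exp[of "5::int" _ 1] by (simp_all del: power_one_right)
      hence rt: "r 1 = 1" "t 1 = 2" by auto
      \<comment> \<open>The value is
        \<open>55\<^sup>2 * 5\<^sup>2 - 4 * 55\<^sup>2 * 5 + 4 = 15129\<close>.\<close>
      have "x\<^sup>2 = 123\<^sup>2" unfolding E 3 by simp
      hence "x = 123" using assms(6) by (simp only: power2_eq_iff_nonneg)
      thus ?thesis using 3 s rt k ab b \<delta> by simp
    qed
  next
    assume "?exc \<or> ?A \<or> ?B"
    then consider ?exc | ?A | ?B by blast
    thus ?eq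
    proof cases
      case 1
      thus ?thesis by simp
    next
      case 2
      have x: "x = U\<^sup>2 * V - 2 * \<epsilon>" and y: "y = U" using 2 pab \<delta> by (auto simp: U_def R_def)
      show ?thesis unfolding eq unfolding x y using \<epsilon> by (auto simp: power2_eq_square algebra_simps)
    next
      case 3
      have ab: "a = b" and y: "y = R" using 3 by (auto simp: R_def)
      have "p ^ (2 * b) = (p ^ b)\<^sup>2" by (simp add: mult.commute flip: power_mult)
      hence x: "x = (p ^ b)\<^sup>2 - 2" using 3 by linarith
      have Pe: "R\<^sup>2 * V1 = p ^ b + 2 * \<epsilon>" using 3 KR \<delta> by simp
      have UV: "U\<^sup>2 * V\<^sup>2 * y\<^sup>2 = (p ^ b)\<^sup>2 * (R\<^sup>2 * V1) * (R\<^sup>2 * V1)" "U\<^sup>2 * V = (p ^ b)\<^sup>2 * (R\<^sup>2 * V1)"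
        unfolding U_def V_def ab y by (simp_all add: power2_eq_square mult_ac)
      have "U\<^sup>2 * V\<^sup>2 * y\<^sup>2 - 4 * \<epsilon> * (U\<^sup>2 * V) + 4 = ((p ^ b)\<^sup>2 - 2)\<^sup>2"
        unfolding UV Pe using \<epsilon> by (auto simp: power2_eq_square algebra_simps)
      thus ?thesis unfolding eq unfolding x by (simp add: mult_ac)
    qed
  qed
qed

end
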